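(* Let $K$ be a field of characteristic $0$, $n\ge 2$, and let $f=\sum a_{i_1,\dots,i_n}x_1^{i_1}\cdots x_n^{i_n}\in K[[x_1,\dots,x_n]]$ be D-finite over $K(x_1,\dots,x_n)$. For each $i\in\{1,\dots,n\}$ fix a non-zero $L_i\in K[x_1,\dots,x_n]\langle D_{x_i}\rangle$ with $L_i(f)=0$, of order $r_i$ and degree $d_i$; let $r_f=\max_i r_i$, $d_f=\max_i d_i$. Write $t$ for $x_2$ and let $$\Delta_{2,1}(f)=\sum_{i_1,i_3,\dots,i_n\ge0}a_{i_1,i_1,i_3,\dots,i_n}\,t^{i_1}x_3^{i_3}\cdots x_n^{i_n}\in K[[t,x_3,\dots,x_n]].$$ Then there exists a non-zero operator $P_\alpha\in K[t,x_3,\dots,x_n]\langle D_t\rangle$ with $P_\alpha(\Delta_{2,1}(f))=0$ and $$\deg(P_\alpha)\le 8(d_1+d_2+1)^2(r_1r_2)^2\bigl(8(d_1+d_2+1)^2r_1r_2+1\bigr)=O(d_f^4r_f^6),\qquad \operatorname{ord}(P_\alpha)\le 4(d_1+d_2+1)r_1r_2=O(d_fr_f^2),$$ and for each $h\in\{3,\dots,n\}$ there exists a non-zero operator $P_{h,\alpha_h}\in K[t,x_3,\dots,x_n]\langle D_{x_h}\rangle$ with $P_{h,\alpha_h}(\Delta_{2,1}(f))=0$ and $$\deg(P_{h,\alpha_h})\le 8(d_1+d_2+d_h+1)^2(r_1r_2r_h)^2\bigl(8(d_1+d_2+d_h+1)^2r_1r_2r_h+1\bigr)=O(d_f^4r_f^9),$$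 $$\operatorname{ord}(P_{h,\alpha_h})\le 4(d_1+d_2+d_h+1)r_1r_2r_h=O(d_fr_f^3).$$
   Context: A series $g\in K[[x_1,\dots,x_n]]$ is D-finite over $K(x_1,\dots,x_n)$ if the $K(x_1,\dots,x_n)$-vector space spanned in $K(x_1,\dots,x_n)\otimes_{K[x_1,\dots,x_n]}K[[x_1,\dots,x_n]]$ by all partial derivatives of $g$ is finite-dimensional. For an operator $L=\sum_{j=0}^{r}\ell_j D_{y}^j$ in a single derivation $D_y$ with polynomial coefficients and $\ell_r\neq 0$, its order is $r$ and its degree is the maximum total degree (in all variables) of the coefficients $\ell_j$. *)

theory Defs
  imports Main "HOL-Library.Poly_Mapping"
begin

text \<open>Variables are indexed by natural numbers; the paper's x_1,...,x_n are
  our variables 0,...,n-1.  A monomial is an exponent vector nat =>0 nat.\<close>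

type_synonym monom = "nat \<Rightarrow>\<^sub>0 nat"

type_synonym 'a mpoly = "monom \<Rightarrow>\<^sub>0 'a"

type_synonym 'a mseries = "monom \<Rightarrow> 'a"

text \<open>Differential operators sum_j l_j D^j, coefficient of D^j at j.\<close>
type_synonym 'a dop = "nat \<Rightarrow>\<^sub>0 'a mpoly"

definition monom_in :: "nat set \<Rightarrow> monom \<Rightarrow> bool" where
  "monom_in V m \<longleftrightarrow> Poly_Mapping.keys m \<subseteq> V"

definition poly_in :: "nat set \<Rightarrow> 'a::zero mpoly \<Rightarrow> bool" where
  "poly_in V p \<longleftrightarrow> (\<forall>m \<in> Poly_Mapping.keys p. monom_in V m)"

definition series_in :: "nat set \<Rightarrow> 'a::zero mseries \<Rightarrow> bool" where
  "series_in V f \<longleftrightarrow> (\<forall>m. \<not> monom_in V m \<longrightarrow> f m = 0)"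

definition dop_in :: "nat set \<Rightarrow> 'a::zero dop \<Rightarrow> bool" where
  "dop_in V L \<longleftrightarrow> (\<forall>j. poly_in V (Poly_Mapping.lookup L j))"

definition pmult :: "'a::comm_ring_1 mpoly \<Rightarrow> 'a mseries \<Rightarrow> 'a mseries" where
  "pmult p f = (\<lambda>m. \<Sum>a\<in>Poly_Mapping.keys p.
      if (\<forall>v. Poly_Mapping.lookup a v \<le> Poly_Mapping.lookup m v) then Poly_Mapping.lookup p a * f (m - a) else 0)"

definition sderiv :: "nat \<Rightarrow> 'a::comm_ring_1 mseries \<Rightarrow> 'a mseries" where
  "sderiv i f = (\<lambda>m. of_nat (Poly_Mapping.lookup m i + 1) * f (m + Poly_Mapping.single i 1))"

definition sderiv_multi :: "nat \<Rightarrow> monom \<Rightarrow> 'a::comm_ring_1 mseries \<Rightarrow> 'a mseries" where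
  "sderiv_multi n \<alpha> f = foldr (\<lambda>i g. (sderiv i ^^ Poly_Mapping.lookup \<alpha> i) g) [0..<n] f"

definition series_add :: "'a::comm_ring_1 mseries \<Rightarrow> 'a mseries \<Rightarrow> 'a mseries" where
  "series_add f g = (\<lambda>m. f m + g m)"

definition dop_apply :: "nat \<Rightarrow> 'a::comm_ring_1 dop \<Rightarrow> 'a mseries \<Rightarrow> 'a mseries" where
  "dop_apply i L f = (\<lambda>m. \<Sum>j\<in>Poly_Mapping.keys L. pmult (Poly_Mapping.lookup L j) ((sderiv i ^^ j) f) m)"

definition tdeg :: "'a::zero mpoly \<Rightarrow> nat" where
  "tdeg p = Max (insert 0 ((\<lambda>m. \<Sum>v\<in>Poly_Mapping.keys m. Poly_Mapping.lookup m v) ` Poly_Mapping.keys p))"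

definition dop_ord :: "'a::zero dop \<Rightarrow> nat" where
  "dop_ord L = Max (Poly_Mapping.keys L)"

definition dop_deg :: "'a::zero dop \<Rightarrow> nat" where
  "dop_deg L = Max (insert 0 ((\<lambda>j. tdeg (Poly_Mapping.lookup L j)) ` Poly_Mapping.keys L))"

text \<open>D-finiteness (literal unfolding of the definition): the span over the
  rational function field K(x_1..x_n) of all partial derivatives of f inside
  K(x) \<otimes> K[[x]] is finite-dimensional, i.e. there is a finite set G of series
  such that every derivative is a K(x)-linear combination of G; after clearing
  denominators (K[[x]] is a domain, so the localisation map is injective):
  q * D^alpha f = sum_{g in G} c_g * g with q a non-zero polynomial.\<close>
definition dfinite :: "nat \<Rightarrow> 'a::field_char_0 mseries \<Rightarrow> bool" where
  "dfinite n f \<longleftrightarrow> (\<exists>G. finite G \<and> (\<forall>g\<in>G. series_in {..<n} g) \<and>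
      (\<forall>\<alpha>. monom_in {..<n} \<alpha> \<longrightarrow>
         (\<exists>q c. q \<noteq> 0 \<and> poly_in {..<n} q \<and> (\<forall>g\<in>G. poly_in {..<n} (c g)) \<and>
            pmult q (sderiv_multi n \<alpha> f) =
              (\<lambda>m. \<Sum>g\<in>G. pmult (c g) g m))))"

text \<open>Diagonal Delta_{2,1}: the paper's x_1, x_2 are our variables 0, 1;
  t is variable 1; the result lives in the variables 1..n-1.\<close>
definition diag21 :: "'a::zero mseries \<Rightarrow> 'a mseries" where
  "diag21 f = (\<lambda>m. if Poly_Mapping.lookup m 0 = 0
                   then f (m + Poly_Mapping.single 0 (Poly_Mapping.lookup m 1)) else 0)"

end

theory Submission
  imports Defs "HOL-Library.Function_Algebras" "HOL-Library.FuncSet"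
    Jordan_Normal_Form.Determinant
begin

text \<open>The diagonal is the residue at \<open>s = 0\<close> of \<open>F = s\<^sup>-\<^sup>1 f(s, t/s, x\<^sub>2, \<dots>)\<close>. Let \<open>D\<^sub>y\<close> be the
  derivation of the operator sought, and let \<open>M\<close> and \<open>D\<close> be the product of the orders and one plus the
  sum of the degrees of the operators \<open>L\<^sub>i\<close> involved. After multiplication by a common denominator, all
  \<open>D\<^sub>s\<^sup>a D\<^sub>y\<^sup>b F\<close> with \<open>a + b \<le> N\<close> are combinations of the same \<open>M\<close> derivatives of \<open>f\<close>, with
  coefficients of degree at most \<open>2ND\<close>. For \<open>N = 4DM\<close> there are more of them than the \<open>M (2ND + 1)\<close>
  linear conditions for a relation with coefficients free of \<open>s\<close>, and Cramer's rule bounds the degree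
  of such a relation. Since residues of \<open>s\<close>-derivatives vanish, the part of lowest order \<open>k\<^sub>0\<close> in
  \<open>D\<^sub>s\<close>, multiplied by \<open>s\<close> to the power \<open>k\<^sub>0\<close>, yields an operator that annihilates the diagonal.
  No Laurent series are needed: with \<open>s = x\<^sub>0\<close> and \<open>t = x\<^sub>0 x\<^sub>1\<close> everything can be cleared of negative
  powers of \<open>s\<close> and carried out on power series in the original variables.\<close>

abbreviation lookup where "lookup \<equiv> Poly_Mapping.lookup"
abbreviation keys where "keys \<equiv> Poly_Mapping.keys"
abbreviation single where "single \<equiv> Poly_Mapping.single"

section \<open>Finitely supported functions as sums of single terms\<close>

lemma poly_mapping_eq_sum_single:
  fixes p :: "'a \<Rightarrow>\<^sub>0 'b::comm_monoid_add"
  shows "p = (\<Sum>a\<in>keys p. single a (lookup p a))"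
proof (rule poly_mapping_eqI)
  fix k
  have "lookup (\<Sum>a\<in>keys p. single a (lookup p a)) k = (\<Sum>a\<in>keys p. if a = k then lookup p a else 0)"
    by (simp add: lookup_sum lookup_single when_def)
  also have "\<dots> = lookup p k"
    by (auto simp: in_keys_iff)
  finally show "lookup p k = lookup (\<Sum>a\<in>keys p. single a (lookup p a)) k" by simp
qed

lemma poly_mapping_add_induct [case_names zero single add]:
  fixes p :: "'a \<Rightarrow>\<^sub>0 'b::comm_monoid_add"
  assumes "P 0" "\<And>a c. P (single a c)" "\<And>p q. P p \<Longrightarrow> P q \<Longrightarrow> P (p + q)"
  shows "P p"
proof -
  have "P (\<Sum>a\<in>S. single a (lookup p a))" if "finite S" for S
    using that by (induction S rule: finite_induct) (auto intro: assms)
  then show ?thesis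
    using poly_mapping_eq_sum_single[of p] finite_keys by metis
qed

subsection \<open>Polynomials acting on power series\<close>

lemma monom_le_iff: "(\<forall>v. lookup a v \<le> lookup m v) \<longleftrightarrow> (\<exists>k. m = a + (k::monom))"
proof
  assume "\<forall>v. lookup a v \<le> lookup m v"
  then have "m = a + (m - a)"
    by (intro poly_mapping_eqI) (simp add: lookup_add lookup_minus)
  then show "\<exists>k. m = a + k" ..
qed (auto simp: lookup_add)

text \<open>This is multiplication of a series by the monomial x^a; \<open>pmult\<close> is a finite
  combination of such shifts.\<close>

definition mshift :: "monom \<Rightarrow> 'a::zero mseries \<Rightarrow> 'a mseries" where
  "mshift a f m = (if \<forall>v. lookup a v \<le> lookup m v then f (m - a) else 0)"

lemma mshift_add_arg [simp]: "mshift a f (a + k) = f k"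
  by (auto simp: mshift_def lookup_add)

lemma mshift_eq_0: "(\<And>k. m \<noteq> a + k) \<Longrightarrow> mshift a f m = 0"
  unfolding mshift_def monom_le_iff by auto

text \<open>Each case quantifies over the series, so a single split at a fixed exponent settles
  every shift by \<open>a\<close> that occurs in an identity of coefficients.\<close>

lemma mshift_cases:
  obtains k where "m = a + k" "\<And>f. mshift a f m = (f k :: 'a::zero)"
  | "\<And>k. m \<noteq> a + k" "\<And>f. mshift a f m = (0 :: 'a)"
proof (cases "\<exists>k. m = a + k")
  case True
  then show thesis using that(1) mshift_add_arg by blast
next
  case False
  then show thesis using that(2) mshift_eq_0 by blast
qed

lemma mshift_mshift: "mshift a (mshift b f) = mshift (a + b) f"
proof
  fix m
  show "mshift a (mshift b f) m = mshift (a + b) f m"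
  proof (rule mshift_cases[of m a])
    fix k assume k: "m = a + k" "\<And>f. mshift a f m = (f k :: 'a)"
    show ?thesis
    proof (rule mshift_cases[of k b])
      fix l assume l: "k = b + l" "\<And>f. mshift b f k = (f l :: 'a)"
      have "m = (a + b) + l" using k(1) l(1) by (simp add: add.assoc)
      then show ?thesis using k(2) l(2) by simp
    next
      assume l: "\<And>l. k \<noteq> b + l" "\<And>f. mshift b f k = (0 :: 'a)"
      then have "m \<noteq> (a + b) + l" for l using k(1) by (auto simp: add.assoc)
      then show ?thesis using k(2) l(2) by (simp add: mshift_eq_0)
    qed
  next
    assume k: "\<And>k. m \<noteq> a + k" "\<And>f. mshift a f m = (0 :: 'a)"
    then have "m \<noteq> (a + b) + l" for l by (auto simp: add.assoc)
    then show ?thesis using k(2) by (simp add: mshift_eq_0)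
  qed
qed

lemma mshift_add_add: "mshift (c + a) f (c + m) = mshift a f m"
  by (simp flip: mshift_mshift)

lemma mshift_plus: "mshift a (f + g) = mshift a f + mshift a (g :: 'a::comm_ring_1 mseries)"
  by (auto simp: mshift_def fun_eq_iff)

text \<open>A finite superset of the support provides a common index set for two polynomials, as
  additivity in \<open>p\<close> requires.\<close>

lemma pmult_superset:
  assumes "finite S" "keys p \<subseteq> S"
  shows "pmult p f m = (\<Sum>a\<in>S. lookup p a * mshift a f m)"
proof -
  have "pmult p f m = (\<Sum>a\<in>keys p. lookup p a * mshift a f m)"
    unfolding pmult_def mshift_def by (intro sum.cong) auto
  also have "\<dots> = (\<Sum>a\<in>S. lookup p a * mshift a f m)"
    using assms by (intro sum.mono_neutral_left) (auto simp: in_keys_iff)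
  finally show ?thesis .
qed

lemma pmult_single: "pmult (single a c) f = (\<lambda>m. c * mshift a f m)"
  by (rule ext, subst pmult_superset[of "{a}"]) auto

lemma pmult_add_left: "pmult (p + q) f = pmult p f + pmult q f"
proof
  fix m
  have "finite (keys p \<union> keys q)" by simp
  note * = pmult_superset[OF this]
  show "pmult (p + q) f m = (pmult p f + pmult q f) m"
    using Poly_Mapping.keys_add[of p q]
    by (simp add: * lookup_add distrib_right sum.distrib)
qed

lemma pmult_add_right: "pmult p (f + g) = pmult p f + pmult p g"
  by (rule ext) (simp add: pmult_superset[OF finite_keys subset_refl] mshift_plus
      distrib_left sum.distrib)

lemma pmult_0_left: "pmult 0 f = 0"
  by (auto simp: pmult_def)

lemma pmult_mult: "pmult (p * q) f = pmult p (pmult q f)"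
proof (induction p rule: poly_mapping_add_induct)
  case (single a c)
  show ?case
  proof (induction q rule: poly_mapping_add_induct)
    case (single b d)
    have "mshift a (\<lambda>m. d * mshift b f m) m = d * mshift (a + b) f m" for m
      unfolding mshift_mshift[symmetric] by (rule mshift_cases[where ?'a = 'a, of m a]) auto
    then show ?case
      by (simp add: mult_single pmult_single mult.assoc)
  next
    case zero
    show ?case by (simp add: pmult_0_left pmult_single mshift_def fun_eq_iff)
  qed (simp only: pmult_add_left pmult_add_right distrib_left)
qed (simp_all add: pmult_add_left pmult_0_left distrib_right)

text \<open>Power series become a module over the polynomials, so the general rules for scaling
  sums, zero and negatives apply.\<close>

lemma module_pmult: "Modules.module (pmult :: 'a::comm_ring_1 mpoly \<Rightarrow> _)"
proof
  fix x :: "'a mseries"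
  show "pmult 1 x = x"
    using pmult_single[of 0 1 x] mshift_add_arg[of 0 x] by (simp add: single_one)
qed (simp_all add: pmult_add_left pmult_add_right pmult_mult)

interpretation pmult: Modules.module "pmult :: 'a::comm_ring_1 mpoly \<Rightarrow> _"
  by (rule module_pmult)

lemma lookup_plus_fun: "lookup (p + q) = lookup p + lookup q"
  by (rule ext) (simp add: lookup_add)

text \<open>Through \<open>lookup\<close> a polynomial is itself a series, so operations on series,
  such as extracting coefficients along the fibre, also act on polynomial coefficients.\<close>

lemma lookup_mult_eq_pmult: "lookup (p * q) = pmult p (lookup q)"
proof (induction p rule: poly_mapping_add_induct)
  case (single a c)
  show ?case
  proof (induction q rule: poly_mapping_add_induct)
    case (single b d)
    show ?case
    proof
      fix m
      show "lookup (single a c * single b d) m = pmult (single a c) (lookup (single b d)) m"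
        by (rule mshift_cases[where ?'a = 'a, of m a])
          (auto simp: mult_single pmult_single lookup_single when_def)
    qed
  next
    case zero
    show ?case by (simp add: fun_eq_iff pmult_single mshift_def)
  qed (simp only: distrib_left lookup_plus_fun pmult_add_right)
next
  case zero
  show ?case by (simp add: fun_eq_iff pmult_def)
qed (simp add: distrib_right lookup_plus_fun pmult_add_left)

subsection \<open>Degrees\<close>

definition mdeg :: "monom \<Rightarrow> nat" where
  "mdeg m = (\<Sum>v\<in>keys m. lookup m v)"

lemma mdeg_superset: "finite S \<Longrightarrow> keys m \<subseteq> S \<Longrightarrow> mdeg m = (\<Sum>v\<in>S. lookup m v)"
  unfolding mdeg_def by (intro sum.mono_neutral_left) (auto simp: in_keys_iff)

lemma mdeg_add [simp]: "mdeg (a + b) = mdeg a + mdeg b"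
proof -
  have "finite (keys a \<union> keys b)" by simp
  note * = mdeg_superset[OF this]
  show ?thesis
    using Poly_Mapping.keys_add[of a b]
    by (simp add: * lookup_add sum.distrib)
qed

lemma mdeg_0 [simp]: "mdeg 0 = 0"
  by (simp add: mdeg_def)

lemma mdeg_single [simp]: "mdeg (single i k) = k"
  by (simp add: mdeg_def)

lemma lookup_le_mdeg: "lookup m v \<le> mdeg m"
proof (cases "v \<in> keys m")
  case True
  then show ?thesis
    unfolding mdeg_def by (intro member_le_sum) auto
qed (simp add: in_keys_iff)

lemma keys_add_monom [simp]: "keys (a + b) = keys a \<union> keys (b :: monom)"
  by (auto simp: in_keys_iff lookup_add)

text \<open>An exponent vector supported in \<open>V\<close> is determined by its restriction to
  \<open>V\<close>, which embeds the box into a finite product of intervals.\<close>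

lemma
  assumes "finite V"
  shows finite_monom_box: "finite {m::monom. keys m \<subseteq> V \<and> (\<forall>v\<in>V. lookup m v < r v)}" (is "finite ?A")
    and card_monom_box: "card {m::monom. keys m \<subseteq> V \<and> (\<forall>v\<in>V. lookup m v < r v)} \<le> (\<Prod>v\<in>V. r v)"
proof -
  let ?B = "PiE V (\<lambda>v. {..<r v})"
  have inj: "inj_on (\<lambda>m. restrict (lookup m) V) ?A"
  proof (rule inj_onI)
    fix m m' :: monom
    assume *: "m \<in> ?A" "m' \<in> ?A" "restrict (lookup m) V = restrict (lookup m') V"
    show "m = m'"
    proof (rule poly_mapping_eqI)
      fix v
      show "lookup m v = lookup m' v"
      proof (cases "v \<in> V")
        case True
        then show ?thesis using *(3) by (metis restrict_apply')
      next
        case False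
        then have "v \<notin> keys m" "v \<notin> keys m'" using * by auto
        then show ?thesis by (simp add: in_keys_iff)
      qed
    qed
  qed
  have sub: "(\<lambda>m. restrict (lookup m) V) ` ?A \<subseteq> ?B"
    by (auto intro!: restrict_PiE_iff[THEN iffD2])
  have fin: "finite ?B"
    using assms by (intro finite_PiE) auto
  show "finite ?A"
    using inj sub fin by (meson finite_imageD finite_subset)
  show "card ?A \<le> (\<Prod>v\<in>V. r v)"
    using card_inj_on_le[OF inj sub fin] assms by (simp add: card_PiE)
qed

lemma finite_monom_mdeg:
  assumes "finite V"
  shows "finite {m. keys m \<subseteq> V \<and> mdeg m \<le> k}"
  by (rule finite_subset[OF _ finite_monom_box[OF assms, of "\<lambda>_. Suc k"]])
    (use le_trans[OF lookup_le_mdeg] in \<open>auto simp: less_Suc_eq_le\<close>)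

text \<open>Bounding every monomial separately avoids the maximum in \<open>tdeg\<close>, so closure
  under ring operations can be checked on supports.\<close>

definition bounded_poly :: "nat set \<Rightarrow> nat \<Rightarrow> 'a::zero mpoly \<Rightarrow> bool" where
  "bounded_poly V k p \<longleftrightarrow> (\<forall>m\<in>keys p. keys m \<subseteq> V \<and> mdeg m \<le> k)"

lemma bounded_poly_iff: "bounded_poly V k p \<longleftrightarrow> poly_in V p \<and> tdeg p \<le> k"
  by (auto simp: bounded_poly_def poly_in_def monom_in_def tdeg_def mdeg_def)

lemma bounded_poly_mono: "bounded_poly V k p \<Longrightarrow> k \<le> l \<Longrightarrow> bounded_poly V l p"
  by (force simp: bounded_poly_def)

lemma bounded_poly_0 [simp]: "bounded_poly V k 0"
  by (simp add: bounded_poly_def)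

lemma bounded_poly_single: "keys a \<subseteq> V \<Longrightarrow> mdeg a \<le> k \<Longrightarrow> bounded_poly V k (single a c)"
  by (simp add: bounded_poly_def)

lemma bounded_poly_1 [simp]: "bounded_poly V k (1 :: 'a::comm_ring_1 mpoly)"
  using bounded_poly_single[of 0 V k "1 :: 'a"] by simp

lemma bounded_poly_add: "bounded_poly V k p \<Longrightarrow> bounded_poly V k q \<Longrightarrow> bounded_poly V k (p + q)"
  using Poly_Mapping.keys_add[of p q] by (auto simp: bounded_poly_def)

lemma bounded_poly_uminus: "bounded_poly V k p \<Longrightarrow> bounded_poly V k (- p :: 'a::comm_ring_1 mpoly)"
  by (auto simp: bounded_poly_def in_keys_iff)

lemma bounded_poly_mult:
  "bounded_poly V k p \<Longrightarrow> bounded_poly V l q \<Longrightarrow> bounded_poly V (k + l) (p * q :: 'a::comm_ring_1 mpoly)"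
  using keys_mult[of p q] unfolding bounded_poly_def
  by (auto dest!: subsetD intro!: add_mono)

lemma bounded_poly_sum: "(\<And>i. i \<in> S \<Longrightarrow> bounded_poly V k (p i)) \<Longrightarrow> bounded_poly V k (\<Sum>i\<in>S. p i)"
  by (induction S rule: infinite_finite_induct) (auto intro: bounded_poly_add)

lemma bounded_poly_prod:
  "(\<And>i. i \<in> S \<Longrightarrow> bounded_poly V (k i) (p i :: 'a::comm_ring_1 mpoly)) \<Longrightarrow>
    bounded_poly V (\<Sum>i\<in>S. k i) (\<Prod>i\<in>S. p i)"
  by (induction S rule: infinite_finite_induct) (auto intro: bounded_poly_mult)

lemma bounded_poly_power:
  "bounded_poly V k (p :: 'a::comm_ring_1 mpoly) \<Longrightarrow> bounded_poly V (j * k) (p ^ j)"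
  by (induction j) (auto intro: bounded_poly_mult)

subsection \<open>Power series have no polynomial torsion\<close>

lemma ex_lookup_eq_on:
  assumes "finite S"
  shows "\<exists>p :: 'k \<Rightarrow>\<^sub>0 'a::zero. \<forall>m. lookup p m = (if m \<in> S then g m else 0)"
proof -
  have "finite {m. (if m \<in> S then g m else 0) \<noteq> 0}"
    using assms by (rule rev_finite_subset) auto
  then show ?thesis
    by (intro exI[of _ "Abs_poly_mapping (\<lambda>m. if m \<in> S then g m else 0)"])
      (simp add: Abs_poly_mapping_inverse)
qed

text \<open>The lowest homogeneous part of a product is the product of the lowest homogeneous parts.
  In finitely many variables both parts are polynomials, and polynomials over an integral domain
  have no zero divisors.\<close>

lemma pmult_eq_0_finite_vars:
  fixes g :: "'a::idom mseries"
  assumes V: "finite V" "series_in V g" and p: "p \<noteq> 0" and pg: "pmult p g = 0"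
  shows "g = 0"
proof (rule ccontr)
  assume "g \<noteq> 0"
  then obtain m0 where "g m0 \<noteq> 0" by (auto simp: fun_eq_iff)
  define d where "d = (LEAST d. \<exists>m. g m \<noteq> 0 \<and> mdeg m = d)"
  have "\<exists>m. g m \<noteq> 0 \<and> mdeg m = d"
    unfolding d_def by (rule LeastI_ex) (use \<open>g m0 \<noteq> 0\<close> in auto)
  then obtain m1 where m1: "g m1 \<noteq> 0" "mdeg m1 = d" by blast
  have d_le: "d \<le> mdeg m" if "g m \<noteq> 0" for m
    unfolding d_def by (rule Least_le) (use that in auto)
  define e where "e = (LEAST e. \<exists>m. lookup p m \<noteq> 0 \<and> mdeg m = e)"
  have "\<exists>m. lookup p m \<noteq> 0" using p by (auto simp: poly_mapping_eq_iff fun_eq_iff)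
  then have "\<exists>m. lookup p m \<noteq> 0 \<and> mdeg m = e"
    unfolding e_def by - (rule LeastI_ex, blast)
  then obtain m2 where m2: "lookup p m2 \<noteq> 0" "mdeg m2 = e" by blast
  have e_le: "e \<le> mdeg m" if "lookup p m \<noteq> 0" for m
    unfolding e_def by (rule Least_le) (use that in auto)
  let ?S = "{m. keys m \<subseteq> V \<and> mdeg m \<le> d} \<inter> {m. mdeg m = d}"
  have "finite ?S" using finite_monom_mdeg[OF V(1)] by blast
  from ex_lookup_eq_on[OF this, of g] obtain g0
    where g0: "\<And>m. lookup g0 m = (if m \<in> ?S then g m else 0)" by blast
  have g0': "lookup g0 m = (if mdeg m = d then g m else 0)" for m
    using V(2) by (auto simp: g0 series_in_def monom_in_def)
  have "finite (keys p \<inter> {m. mdeg m = e})" by simp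
  from ex_lookup_eq_on[OF this, of "lookup p"] obtain p0
    where p0: "\<And>m. lookup p0 m = (if m \<in> keys p \<inter> {m. mdeg m = e} then lookup p m else 0)" by blast
  have p0': "lookup p0 m = (if mdeg m = e then lookup p m else 0)" for m
    by (auto simp: p0 in_keys_iff)
  have keys_p0: "keys p0 \<subseteq> keys p" by (auto simp: in_keys_iff p0' split: if_splits)
  have "lookup (p0 * g0) m = 0" for m
  proof (cases "mdeg m = e + d")
    case True
    have "lookup (p0 * g0) m = (\<Sum>a\<in>keys p. lookup p0 a * mshift a (lookup g0) m)"
      unfolding lookup_mult_eq_pmult by (rule pmult_superset) (use keys_p0 in auto)
    also have "\<dots> = (\<Sum>a\<in>keys p. lookup p a * mshift a g m)"
    proof (rule sum.cong)
      fix a assume "a \<in> keys p"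
      show "lookup p0 a * mshift a (lookup g0) m = lookup p a * mshift a g m"
      proof (rule mshift_cases[of m a])
        fix k assume k: "m = a + k" "\<And>f. mshift a f m = (f k :: 'a)"
        then have "mdeg a + mdeg k = e + d" using True by simp
        moreover have "e \<le> mdeg a" using \<open>a \<in> keys p\<close> e_le by (auto simp: in_keys_iff)
        \<comment> \<open>No degree lies below the minimal ones, so in total degree
          \<open>e + d\<close> only the product of the two lowest parts contributes.\<close>
        ultimately have "mdeg a = e \<and> mdeg k = d \<or> g k = 0"
          using d_le[of k] by linarith
        moreover have "lookup g0 k = 0" if "g k = 0" using that by (simp add: g0')
        ultimately show ?thesis by (auto simp: k(2) p0' g0')
      qed simp
    qed simp
    also have "\<dots> = pmult p g m" by (rule pmult_superset[symmetric]) auto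
    finally show ?thesis using pg by simp
  next
    case False
    have "lookup (p0 * g0) m = (\<Sum>a\<in>keys p0. lookup p0 a * mshift a (lookup g0) m)"
      unfolding lookup_mult_eq_pmult by (rule pmult_superset) auto
    also have "\<dots> = 0"
    proof (intro sum.neutral ballI)
      fix a
      show "lookup p0 a * mshift a (lookup g0) m = 0"
        by (rule mshift_cases[of m a]) (use False in \<open>auto simp: p0' g0'\<close>)
    qed
    finally show ?thesis .
  qed
  then have "p0 * g0 = 0" by (intro poly_mapping_eqI) simp
  moreover have "lookup p0 m2 \<noteq> 0" "lookup g0 m1 \<noteq> 0" using m1 m2 by (simp_all add: g0' p0')
  then have "p0 \<noteq> 0" "g0 \<noteq> 0" by auto
  ultimately show False by simp
qed

text \<open>A series may involve infinitely many variables. Discarding the monomials that use a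
  variable outside those of \<open>p\<close> and of the tested exponent \<open>m0\<close> commutes
  with multiplication by \<open>p\<close> and leaves finitely many variables.\<close>

lemma pmult_eq_0_imp:
  fixes g :: "'a::idom mseries"
  assumes p: "p \<noteq> 0" and pg: "pmult p g = 0"
  shows "g = 0"
proof
  fix m0 :: monom
  define T where "T = keys m0 \<union> (\<Union>a\<in>keys p. keys a)"
  define g' where "g' m = (if keys m \<subseteq> T then g m else 0)" for m
  have T: "keys a \<subseteq> T" if "a \<in> keys p" for a using that by (auto simp: T_def)
  have "pmult p g' m = (if keys m \<subseteq> T then pmult p g m else 0)" for m
  proof -
    have "lookup p a * mshift a g' m = (if keys m \<subseteq> T then lookup p a * mshift a g m else 0)"
      if "a \<in> keys p" for a
      by (rule mshift_cases[where ?'a = 'a, of m a]) (use T[OF that] in \<open>auto simp: g'_def\<close>)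
    then show ?thesis
      by (simp add: pmult_superset[OF finite_keys subset_refl])
  qed
  then have "pmult p g' = 0" using pg by (auto simp: fun_eq_iff)
  moreover have "finite T" by (simp add: T_def)
  moreover have "series_in T g'" by (simp add: series_in_def monom_in_def g'_def)
  ultimately have "g' = 0" using pmult_eq_0_finite_vars p by blast
  then have "g' m0 = 0" by simp
  then show "g m0 = 0 m0" by (simp add: g'_def T_def)
qed

subsection \<open>Derivatives\<close>

text \<open>The truncated subtraction in the exponent is harmless: where x_i does not occur, the
  factor \<open>lookup a i\<close> vanishes.\<close>

definition pder :: "nat \<Rightarrow> 'a::comm_ring_1 mpoly \<Rightarrow> 'a mpoly" where
  "pder i p = (\<Sum>a\<in>keys p. single (a - single i 1) (of_nat (lookup a i) * lookup p a))"

lemma sderiv_plus: "sderiv i (f + g) = sderiv i f + sderiv i g"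
  by (simp add: sderiv_def fun_eq_iff algebra_simps)

lemma sderiv_0: "sderiv i 0 = 0"
  by (simp add: sderiv_def fun_eq_iff)

lemma sderiv_sum: "sderiv i (\<Sum>x\<in>S. g x) = (\<Sum>x\<in>S. sderiv i (g x))"
  by (induction S rule: infinite_finite_induct) (simp_all only: sum.insert sum.empty sum.infinite
      sderiv_plus sderiv_0 simp_thms)

text \<open>Leibniz rule for a monomial times a series. If x_i divides x^a, one factor x_i is split
  off and the Euler operator x_i D_i is evaluated on coefficients.\<close>

lemma sderiv_mshift:
  fixes f :: "'a::comm_ring_1 mseries"
  shows "sderiv i (mshift a f) m =
    of_nat (lookup a i) * mshift (a - single i 1) f m + mshift a (sderiv i f) m"
proof (cases "lookup a i = 0")
  case True
  show ?thesis
  proof (rule mshift_cases[where ?'a = 'a, of m a])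
    fix k assume k: "m = a + k" "\<And>f. mshift a f m = (f k :: 'a)"
    have "mshift a f (m + single i 1) = f (k + single i 1)"
      unfolding k(1) add.assoc by simp
    then show ?thesis
      using True k by (simp add: sderiv_def lookup_add)
  next
    assume k: "\<And>k. m \<noteq> a + k" "\<And>f. mshift a f m = (0 :: 'a)"
    have "mshift a f (m + single i 1) = 0"
    proof (rule ccontr)
      assume "mshift a f (m + single i 1) \<noteq> 0"
      then have "\<forall>v. lookup a v \<le> lookup (m + single i 1) v"
        unfolding mshift_def by presburger
      then have "\<forall>v. lookup a v \<le> lookup m v"
        using True by (metis add.right_neutral lookup_add lookup_single_not_eq zero_le)
      then show False using k(1) monom_le_iff by blast
    qed
    then show ?thesis
      using True k by (simp add: sderiv_def)
  qed
next
  case False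
  define b where "b = a - single i 1"
  have a: "a = single i 1 + b"
    unfolding b_def using False
    by (intro poly_mapping_eqI) (auto simp: lookup_add lookup_minus lookup_single when_def)
  have 1: "mshift a f (m + single i 1) = mshift b f m"
    using mshift_add_add[of "single i 1" b f m] by (simp add: a add.commute)
  have e: "mshift (single i 1) (sderiv i f) m' = of_nat (lookup m' i) * f m'" for m'
  proof (rule mshift_cases[where ?'a = 'a, of m' "single i 1"])
    fix k assume k: "m' = single i 1 + k" "\<And>f. mshift (single i 1) f m' = (f k :: 'a)"
    show ?thesis unfolding k(2) unfolding k(1)
      by (simp add: sderiv_def lookup_add add.commute)
  next
    assume k: "\<And>k. m' \<noteq> single i 1 + k" "\<And>f. mshift (single i 1) f m' = (0 :: 'a)"
    have "lookup m' i = 0"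
    proof (rule ccontr)
      assume "lookup m' i \<noteq> 0"
      then have "\<forall>v. lookup (single i 1) v \<le> lookup m' v"
        by (auto simp: lookup_single when_def)
      then show False using k(1) monom_le_iff by blast
    qed
    then show ?thesis using k by simp
  qed
  have 2: "mshift a (sderiv i f) m = mshift b (\<lambda>m'. of_nat (lookup m' i) * f m') m"
    unfolding a add.commute[of "single i 1" b] mshift_mshift[symmetric] using e by presburger
  show ?thesis
    unfolding 2 b_def[symmetric] unfolding sderiv_def 1
    by (rule mshift_cases[where ?'a = 'a, of m b]) (auto simp: a lookup_add algebra_simps)
qed

lemma sderiv_pmult: "sderiv i (pmult p f) = pmult (pder i p) f + pmult p (sderiv i f)"
proof -
  have 1: "sderiv i (pmult (single a c) f) =
    pmult (single (a - single i 1) (of_nat (lookup a i) * c)) f + pmult (single a c) (sderiv i f)" for a c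
  proof
    fix m
    have "sderiv i (pmult (single a c) f) m = c * sderiv i (mshift a f) m"
      by (simp add: sderiv_def pmult_single algebra_simps)
    then show "sderiv i (pmult (single a c) f) m = (pmult (single (a - single i 1)
      (of_nat (lookup a i) * c)) f + pmult (single a c) (sderiv i f)) m"
      unfolding sderiv_mshift by (simp add: pmult_single algebra_simps)
  qed
  have "sderiv i (pmult p f) = sderiv i (pmult (\<Sum>a\<in>keys p. single a (lookup p a)) f)"
    using poly_mapping_eq_sum_single[of p] by simp
  also have "\<dots> = pmult (pder i p) f + pmult (\<Sum>a\<in>keys p. single a (lookup p a)) (sderiv i f)"
    unfolding pder_def pmult.scale_sum_left sderiv_sum 1 sum.distrib ..
  finally show ?thesis using poly_mapping_eq_sum_single[of p] by simp
qed

lemma bounded_poly_pder: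
  assumes "bounded_poly V k p"
  shows "bounded_poly V k (pder i p)"
  unfolding pder_def
proof (intro bounded_poly_sum bounded_poly_single)
  fix a assume "a \<in> keys p"
  then have a: "keys a \<subseteq> V" "mdeg a \<le> k" using assms by (auto simp: bounded_poly_def)
  have sub: "keys (a - single i 1) \<subseteq> keys a"
    by (auto simp: in_keys_iff lookup_minus)
  then show "keys (a - single i 1) \<subseteq> V" using a by blast
  have "mdeg (a - single i 1) \<le> mdeg a"
    unfolding mdeg_superset[OF finite_keys sub] unfolding mdeg_def
    by (intro sum_mono) (simp add: lookup_minus)
  then show "mdeg (a - single i 1) \<le> k" using a by simp
qed

section \<open>Multi-index derivatives\<close>

definition mfact :: "monom \<Rightarrow> 'a::field_char_0" where
  "mfact m = (\<Prod>v\<in>keys m. fact (lookup m v))"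

lemma mfact_nonzero [simp]: "mfact m \<noteq> 0"
  by (simp add: mfact_def)

lemma mfact_superset:
  assumes "finite S" "keys m \<subseteq> S"
  shows "mfact m = (\<Prod>v\<in>S. fact (lookup m v))"
  unfolding mfact_def by (rule prod.mono_neutral_left) (use assms in \<open>auto simp: in_keys_iff\<close>)

lemma mfact_add_single: "mfact (m + single i 1) = of_nat (lookup m i + 1) * mfact m"
proof -
  let ?S = "insert i (keys m)"
  have "mfact (m + single i 1) = (\<Prod>v\<in>?S. fact (lookup (m + single i 1) v))"
    by (rule mfact_superset) auto
  also have "\<dots> = fact (lookup m i + 1) * (\<Prod>v\<in>?S - {i}. fact (lookup (m + single i 1) v))"
    by (subst prod.remove[of _ i]) (auto simp: lookup_add)
  also have "(\<Prod>v\<in>?S - {i}. fact (lookup (m + single i 1) v)) =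
      (\<Prod>v\<in>?S - {i}. fact (lookup m v) :: 'a)"
    by (intro prod.cong) (auto simp: lookup_add lookup_single)
  also have "fact (lookup m i + 1) * \<dots> = of_nat (lookup m i + 1) * (\<Prod>v\<in>?S. fact (lookup m v))"
    by (subst (2) prod.remove[of _ i]) (auto simp: algebra_simps)
  also have "(\<Prod>v\<in>?S. fact (lookup m v)) = (mfact m :: 'a)"
    by (rule mfact_superset[symmetric]) auto
  finally show ?thesis .
qed

text \<open>The closed form with factorials, available in characteristic 0, makes composition a
  cancellation and the commutation of partial derivatives automatic.\<close>

definition mderiv :: "monom \<Rightarrow> 'a::field_char_0 mseries \<Rightarrow> 'a mseries" where
  "mderiv a f = (\<lambda>m. mfact (m + a) / mfact m * f (m + a))"

lemma mderiv_0 [simp]: "mderiv 0 f = f"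
  by (simp add: mderiv_def)

lemma mderiv_mderiv: "mderiv a (mderiv b f) = mderiv (a + b) f"
  by (simp add: mderiv_def fun_eq_iff add.assoc)

lemma sderiv_eq_mderiv: "sderiv i f = mderiv (single i 1) f"
  by (simp add: sderiv_def mderiv_def fun_eq_iff mfact_add_single[simplified])

lemma sderiv_funpow_eq_mderiv: "(sderiv i ^^ k) f = mderiv (single i k) f"
proof (induction k)
  case (Suc k)
  then show ?case
    by (simp add: sderiv_eq_mderiv mderiv_mderiv flip: single_add)
qed simp

lemma mderiv_plus: "mderiv a (f + g) = mderiv a f + mderiv a g"
  by (simp add: mderiv_def fun_eq_iff algebra_simps)

lemma mderiv_zero: "mderiv a 0 = 0"
  by (simp add: mderiv_def fun_eq_iff)

lemma mderiv_sum: "mderiv a (\<Sum>x\<in>S. g x) = (\<Sum>x\<in>S. mderiv a (g x))"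
  by (induction S rule: infinite_finite_induct) (simp_all only: sum.insert sum.empty sum.infinite
      mderiv_plus mderiv_zero simp_thms)

subsection \<open>Spans with bounded polynomial coefficients\<close>

text \<open>Building combinations one summand at a time allows an infinite \<open>B\<close> and
  proofs by rule induction; for finite \<open>B\<close>, \<open>pspan_finiteE\<close> recovers
  explicit coefficients.\<close>

inductive_set pspan :: "nat set \<Rightarrow> nat \<Rightarrow> 'a::comm_ring_1 mseries set \<Rightarrow> 'a mseries set"
  for V d B where
  pspan_zero: "0 \<in> pspan V d B"
| pspan_step: "g \<in> pspan V d B \<Longrightarrow> b \<in> B \<Longrightarrow> bounded_poly V d p \<Longrightarrow> pmult p b + g \<in> pspan V d B"

lemma pspan_base: "b \<in> B \<Longrightarrow> bounded_poly V d p \<Longrightarrow> pmult p b \<in> pspan V d B"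
  using pspan_step[OF pspan_zero] by force

lemma pspan_add: "g \<in> pspan V d B \<Longrightarrow> h \<in> pspan V d B \<Longrightarrow> g + h \<in> pspan V d B"
  by (induction rule: pspan.induct) (simp_all only: add_0 add.assoc pspan_step)

lemma pspan_sum: "(\<And>x. x \<in> S \<Longrightarrow> g x \<in> pspan V d B) \<Longrightarrow> (\<Sum>x\<in>S. g x) \<in> pspan V d B"
  by (induction S rule: infinite_finite_induct)
    (simp_all only: sum.insert sum.empty sum.infinite pspan_zero pspan_add insertI1 insertI2 simp_thms)

lemma pspan_mono:
  assumes "g \<in> pspan V d B" "d \<le> d'" "B \<subseteq> B'"
  shows "g \<in> pspan V d' B'"
  using assms(1)
proof induction
  case (pspan_step g b p)
  then show ?case
    using assms(2,3) by (intro pspan.pspan_step) (auto intro: bounded_poly_mono)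
qed (rule pspan_zero)

text \<open>The factor \<open>q\<close> commutes past the outer coefficients and is absorbed in the
  expansion of the generators, so only the degrees \<open>d\<close> and \<open>e\<close> add
  up.\<close>

lemma pspan_pmult_trans:
  assumes "g \<in> pspan V d B" and B: "\<And>b. b \<in> B \<Longrightarrow> pmult q b \<in> pspan V e B'"
  shows "pmult q g \<in> pspan V (d + e) B'"
  using assms(1)
proof induction
  case (pspan_step g b p)
  have *: "h \<in> pspan V e B' \<Longrightarrow> pmult p h \<in> pspan V (d + e) B'" for h
  proof (induction rule: pspan.induct)
    case (pspan_step h c s)
    have "bounded_poly V (d + e) (p * s)"
      using \<open>bounded_poly V d p\<close> pspan_step by (intro bounded_poly_mult)
    then show ?case
      unfolding pmult_add_right pmult_mult[symmetric]
      using pspan_step by (intro pspan.pspan_step) auto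
  qed (simp only: pmult.scale_zero_right pspan_zero)
  have "pmult q (pmult p b) \<in> pspan V (d + e) B'"
    unfolding pmult.scale_left_commute[of q p] using B pspan_step * by blast
  then show ?case
    unfolding pmult_add_right using pspan_step by (intro pspan_add)
qed (simp only: pmult.scale_zero_right pspan_zero)

lemma pspan_pmult:
  assumes "g \<in> pspan V d B" "bounded_poly V e q"
  shows "pmult q g \<in> pspan V (d + e) B"
  using assms by (intro pspan_pmult_trans) (auto intro: pspan_base)

lemma pspan_uminus: "g \<in> pspan V d B \<Longrightarrow> - g \<in> pspan V d B"
  using pspan_pmult[OF _ bounded_poly_uminus[OF bounded_poly_1], of g V d B 0]
  by (simp only: pmult.scale_minus_left pmult.scale_one add_0_right)

text \<open>By the Leibniz rule, differentiation enlarges the generating set but not the degree of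
  the coefficients.\<close>

lemma pspan_sderiv:
  assumes "g \<in> pspan V d B" "B \<subseteq> B'" "sderiv i ` B \<subseteq> B'"
  shows "sderiv i g \<in> pspan V d B'"
  using assms(1)
proof induction
  case (pspan_step g b p)
  have "pmult (pder i p) b \<in> pspan V d B'" "pmult p (sderiv i b) \<in> pspan V d B'"
    using pspan_step assms by (auto intro!: pspan_base bounded_poly_pder)
  then show ?case
    unfolding sderiv_plus sderiv_pmult using pspan_step by (intro pspan_add)
qed (simp only: sderiv_0 pspan_zero)

lemma pspan_finiteE:
  assumes "g \<in> pspan V d B" "finite B"
  obtains p where "\<And>b. bounded_poly V d (p b)" "g = (\<Sum>b\<in>B. pmult (p b) b)"
proof -
  have "\<exists>p. (\<forall>b. bounded_poly V d (p b)) \<and> g = (\<Sum>b\<in>B. pmult (p b) b)"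
    using assms(1)
  proof induction
    case pspan_zero
    show ?case
      by (rule exI[of _ "\<lambda>_. 0"]) (simp only: pmult.scale_zero_left sum.neutral_const bounded_poly_0 simp_thms)
  next
    case (pspan_step g b q)
    then obtain p where p: "\<And>b. bounded_poly V d (p b)" "g = (\<Sum>b\<in>B. pmult (p b) b)" by blast
    define p' where "p' = p(b := q + p b)"
    have "pmult q b + g = pmult q b + (pmult (p b) b + (\<Sum>c\<in>B - {b}. pmult (p c) c))"
      unfolding p(2) using \<open>finite B\<close> \<open>b \<in> B\<close> by (subst sum.remove) auto
    also have "\<dots> = pmult (p' b) b + (\<Sum>c\<in>B - {b}. pmult (p' c) c)"
      by (simp add: p'_def pmult_add_left add.assoc)
    also have "\<dots> = (\<Sum>c\<in>B. pmult (p' c) c)"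
      using \<open>finite B\<close> \<open>b \<in> B\<close> by (subst sum.remove[of _ b]) auto
    finally have "pmult q b + g = (\<Sum>c\<in>B. pmult (p' c) c)" .
    moreover have "\<And>b. bounded_poly V d (p' b)"
      using p(1) pspan_step by (auto simp: p'_def intro: bounded_poly_add)
    ultimately show ?case by blast
  qed
  then show ?thesis using that by blast
qed

section \<open>Reduction of higher derivatives modulo the given equations\<close>

lemma monom_induct [case_names zero add_single]:
  assumes "P 0" "\<And>(a::monom) i. P a \<Longrightarrow> P (a + single i 1)"
  shows "P a"
proof (induction "mdeg a" arbitrary: a)
  case 0
  have "lookup a v = 0" for v using lookup_le_mdeg[of a v] 0 by simp
  then have "a = 0" by (intro poly_mapping_eqI) simp
  then show ?case using assms(1) by simp
next
  case (Suc k)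
  have "a \<noteq> 0" using Suc(2) by auto
  then obtain i where i: "lookup a i \<noteq> 0" by (metis lookup_zero poly_mapping_eqI)
  have a: "a = (a - single i 1) + single i 1"
    using i by (intro poly_mapping_eqI) (auto simp: lookup_add lookup_minus lookup_single when_def)
  have "mdeg a = mdeg (a - single i 1) + 1"
    by (subst a) (simp only: mdeg_add mdeg_single)
  then have "P (a - single i 1)" using Suc by simp
  then show ?case by (subst a) (rule assms(2))
qed

definition derivs :: "nat set \<Rightarrow> nat \<Rightarrow> 'a::field_char_0 mseries \<Rightarrow> 'a mseries set" where
  "derivs I k f = {mderiv a f | a. keys a \<subseteq> I \<and> mdeg a < k}"

lemma derivs_mono: "k \<le> l \<Longrightarrow> derivs I k f \<subseteq> derivs I l f"
  by (auto simp: derivs_def)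

lemma mderiv_in_derivs: "keys a \<subseteq> I \<Longrightarrow> mdeg a < k \<Longrightarrow> mderiv a f \<in> derivs I k f"
  by (auto simp: derivs_def)

lemma pspan_derivs_sderiv:
  assumes "g \<in> pspan V d (derivs I k f)" "i \<in> I"
  shows "sderiv i g \<in> pspan V d (derivs I (Suc k) f)"
proof (rule pspan_sderiv[OF assms(1)])
  show "sderiv i ` derivs I k f \<subseteq> derivs I (Suc k) f"
    using assms(2) by (fastforce simp: derivs_def sderiv_eq_mderiv mderiv_mderiv)
qed (simp add: derivs_mono)

text \<open>In the iterated Leibniz rule, a derivative that falls on a coefficient is lost for the
  series. Hence everything but the leading term has smaller total order, while the coefficient
  degrees do not grow.\<close>

lemma mderiv_pmult:
  assumes p: "bounded_poly V d p" and a: "keys a \<subseteq> I" and b: "keys b \<subseteq> I"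
  shows "\<exists>h \<in> pspan V d (derivs I (mdeg a + mdeg b) f).
    mderiv a (pmult p (mderiv b f)) = pmult p (mderiv (a + b) f) + h"
  using a
proof (induction a rule: monom_induct)
  case zero
  show ?case by (rule bexI[OF _ pspan_zero]) simp
next
  case (add_single a i)
  then have i: "i \<in> I" and a: "keys a \<subseteq> I" by auto
  with add_single obtain h where h: "h \<in> pspan V d (derivs I (mdeg a + mdeg b) f)"
    and eq: "mderiv a (pmult p (mderiv b f)) = pmult p (mderiv (a + b) f) + h" by blast
  have *: "mderiv (a + single i 1) g = sderiv i (mderiv a g)" for g :: "'a mseries"
    by (simp add: sderiv_eq_mderiv mderiv_mderiv add.commute)
  have "mderiv (a + single i 1) (pmult p (mderiv b f)) =
    pmult p (mderiv (a + single i 1 + b) f) + (pmult (pder i p) (mderiv (a + b) f) + sderiv i h)"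
    unfolding * eq sderiv_plus sderiv_pmult
    by (simp add: sderiv_eq_mderiv mderiv_mderiv ac_simps)
  moreover have "pmult (pder i p) (mderiv (a + b) f) + sderiv i h
      \<in> pspan V d (derivs I (Suc (mdeg a + mdeg b)) f)"
    using a b p i h
    by (intro pspan_add pspan_base mderiv_in_derivs bounded_poly_pder pspan_derivs_sderiv) auto
  moreover have "mdeg (a + single i 1) + mdeg b = Suc (mdeg a + mdeg b)" by simp
  ultimately show ?case by metis
qed

text \<open>These derivatives lie below the order of every equation. Up to a power of the product of
  the leading coefficients they generate all others, and there are at most as many as the product of
  the orders.\<close>

definition box_derivs :: "nat set \<Rightarrow> (nat \<Rightarrow> nat) \<Rightarrow> 'a::field_char_0 mseries \<Rightarrow> 'a mseries set" where
  "box_derivs I r f = (\<lambda>a. mderiv a f) ` {a. keys a \<subseteq> I \<and> (\<forall>i\<in>I. lookup a i < r i)}"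

text \<open>Each reduction of a derivative outside the box by one of the equations costs a single factor
  \<open>q\<close>, because the lower terms have strictly smaller total order; this keeps the degree linear
  in the order.\<close>

lemma pmult_power_mderiv_in_pspan:
  fixes f :: "'a::field_char_0 mseries"
  assumes I: "finite I"
    and l: "\<And>i j. i \<in> I \<Longrightarrow> bounded_poly V (d i) (l i j)"
    and eqs: "\<And>i. i \<in> I \<Longrightarrow> (\<Sum>j\<le>r i. pmult (l i j) (mderiv (single i j) f)) = 0"
    and r: "\<And>i. i \<in> I \<Longrightarrow> 0 < r i"
    and a: "keys a \<subseteq> I" "mdeg a \<le> k"
  defines "q \<equiv> \<Prod>i\<in>I. l i (r i)"
  shows "pmult (q ^ k) (mderiv a f) \<in> pspan V (k * (\<Sum>i\<in>I. d i)) (box_derivs I r f)"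
  using a
proof (induction k arbitrary: a)
  case 0
  have "lookup a v = 0" for v using lookup_le_mdeg[of a v] 0 by simp
  then have "mderiv a f \<in> box_derivs I r f"
    using 0 r by (auto simp: box_derivs_def)
  then show ?case by (intro pspan_base) auto
next
  case (Suc k)
  let ?D = "\<Sum>i\<in>I. d i"
  have q: "bounded_poly V ?D q"
    unfolding q_def by (intro bounded_poly_prod l)
  show ?case
  proof (cases "\<forall>i\<in>I. lookup a i < r i")
    case True
    then have "mderiv a f \<in> box_derivs I r f"
      using Suc.prems by (auto simp: box_derivs_def)
    then show ?thesis using q by (intro pspan_base bounded_poly_power)
  next
    case False
    then obtain i where i: "i \<in> I" "r i \<le> lookup a i" by force
    \<comment> \<open>Equation \<open>i\<close>, differentiated by \<open>b\<close>, has the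
      derivative of \<open>f\<close> by \<open>a\<close> as its leading term.\<close>
    define b where "b = a - single i (r i)"
    have ab: "a = b + single i (r i)"
      unfolding b_def using i(2)
      by (intro poly_mapping_eqI) (auto simp: lookup_add lookup_minus lookup_single when_def)
    have kb: "keys b \<subseteq> I" and mb: "mdeg a = mdeg b + r i"
      using Suc.prems(1) ab by auto
    let ?B = "derivs I (mdeg a) f"
    have "\<forall>j\<in>{..r i}. \<exists>h. h \<in> pspan V (d i) ?B \<and>
      mderiv b (pmult (l i j) (mderiv (single i j) f)) = pmult (l i j) (mderiv (b + single i j) f) + h"
    proof
      fix j assume "j \<in> {..r i}"
      then have j: "j \<le> r i" by simp
      have ksj: "keys (single i j) \<subseteq> I" using i by auto
      obtain h where "h \<in> pspan V (d i) (derivs I (mdeg b + mdeg (single i j)) f)"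
        and "mderiv b (pmult (l i j) (mderiv (single i j) f)) = pmult (l i j) (mderiv (b + single i j) f) + h"
        using mderiv_pmult[OF l[OF i(1)] kb ksj] by blast
      moreover from this(1) have "h \<in> pspan V (d i) ?B"
        by (rule pspan_mono) (use j mb in \<open>auto intro!: derivs_mono\<close>)
      ultimately show "\<exists>h. h \<in> pspan V (d i) ?B \<and>
        mderiv b (pmult (l i j) (mderiv (single i j) f)) = pmult (l i j) (mderiv (b + single i j) f) + h"
        by blast
    qed
    from bchoice[OF this] obtain h where h: "\<And>j. j \<le> r i \<Longrightarrow> h j \<in> pspan V (d i) ?B"
      "\<And>j. j \<le> r i \<Longrightarrow> mderiv b (pmult (l i j) (mderiv (single i j) f)) = pmult (l i j) (mderiv (b + single i j) f) + h j"
      by auto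
    have "0 = mderiv b (\<Sum>j\<le>r i. pmult (l i j) (mderiv (single i j) f))"
      using eqs[OF i(1)] mderiv_zero by metis
    also have "\<dots> = (\<Sum>j\<le>r i. pmult (l i j) (mderiv (b + single i j) f) + h j)"
      unfolding mderiv_sum by (intro sum.cong h(2)) auto
    also have "\<dots> = (\<Sum>j\<le>r i. pmult (l i j) (mderiv (b + single i j) f)) + (\<Sum>j\<le>r i. h j)"
      by (rule sum.distrib)
    also have "(\<Sum>j\<le>r i. pmult (l i j) (mderiv (b + single i j) f)) =
      pmult (l i (r i)) (mderiv a f) + (\<Sum>j<r i. pmult (l i j) (mderiv (b + single i j) f))"
      unfolding ab lessThan_Suc_atMost[symmetric] sum.lessThan_Suc by (rule add.commute)
    finally have "pmult (l i (r i)) (mderiv a f) =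
      - ((\<Sum>j<r i. pmult (l i j) (mderiv (b + single i j) f)) + (\<Sum>j\<le>r i. h j))"
      by (metis (no_types, lifting) add.assoc eq_neg_iff_add_eq_0)
    also have "\<dots> \<in> pspan V (d i) ?B"
    proof (intro pspan_uminus pspan_add pspan_sum)
      fix j assume j: "j \<in> {..<r i}"
      have "keys (b + single i j) \<subseteq> I" using kb i by auto
      moreover have "mdeg (b + single i j) < mdeg a" using j mb by simp
      ultimately show "pmult (l i j) (mderiv (b + single i j) f) \<in> pspan V (d i) ?B"
        using l[OF i(1)] by (intro pspan_base mderiv_in_derivs)
    qed (use h in auto)
    finally have 1: "pmult (l i (r i)) (mderiv a f) \<in> pspan V (d i) ?B" .
    \<comment> \<open>The other leading coefficients complete the individual factor to the common
      denominator \<open>q\<close>, at the cost of the other degrees.\<close>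
    have "q = (\<Prod>i\<in>I - {i}. l i (r i)) * l i (r i)"
      unfolding q_def using I i(1) by (subst prod.remove[of _ i]) auto
    then have "pmult q (mderiv a f) = pmult (\<Prod>i\<in>I - {i}. l i (r i)) (pmult (l i (r i)) (mderiv a f))"
      by (simp only: pmult_mult)
    also have "\<dots> \<in> pspan V (d i + (\<Sum>i\<in>I - {i}. d i)) ?B"
      by (intro pspan_pmult 1 bounded_poly_prod l) auto
    also have "d i + (\<Sum>i\<in>I - {i}. d i) = ?D"
      using I i(1) by (subst sum.remove[of _ i]) auto
    finally have 2: "pmult q (mderiv a f) \<in> pspan V ?D ?B" .
    \<comment> \<open>One factor \<open>q\<close> has lowered the total order, so the remaining
      \<open>q ^ k\<close> suffices by induction.\<close>
    have "pmult (q ^ k) (pmult q (mderiv a f)) \<in> pspan V (?D + k * ?D) (box_derivs I r f)"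
    proof (rule pspan_pmult_trans[OF 2])
      fix g assume "g \<in> ?B"
      then obtain c where "g = mderiv c f" "keys c \<subseteq> I" "mdeg c < mdeg a" by (auto simp: derivs_def)
      then show "pmult (q ^ k) g \<in> pspan V (k * ?D) (box_derivs I r f)"
        using Suc by auto
    qed
    moreover have "pmult (q ^ Suc k) (mderiv a f) = pmult (q ^ k) (pmult q (mderiv a f))"
      by (simp only: power_Suc2 pmult_mult)
    ultimately show ?thesis by (simp only: mult_Suc)
  qed
qed

subsection \<open>The Euler operator of the fibre direction\<close>

text \<open>With \<open>s = x\<^sub>0\<close> and \<open>t = x\<^sub>0 x\<^sub>1\<close>, this is the operator given by
  \<open>s\<^bsup>a+c+1\<^esup> D\<^sub>s\<^bsup>a\<^esup> (s\<^bsup>-c-1\<^esup> g(s, t/s, \<dots>)) = (fibre_deriv a c g)(s, t/s, \<dots>)\<close>.\<close>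

definition fibre_deriv :: "nat \<Rightarrow> nat \<Rightarrow> 'a::comm_ring_1 mseries \<Rightarrow> 'a mseries" where
  "fibre_deriv a c g = (\<lambda>m. (\<Prod>k<a. of_nat (lookup m 0) - of_nat (lookup m 1) - of_nat c - 1 - of_nat k) * g m)"

lemma mshift_single_sderiv: "mshift (single i 1) (sderiv i f) m = of_nat (lookup m i) * f m"
  using sderiv_mshift[of i "single i 1" f m] mshift_add_arg[of "single i 1" f m]
  by (simp add: sderiv_def algebra_simps mshift_def)

text \<open>The new factor is the eigenvalue of x0 D0 - x1 D1 - (c + 1 + a) on a monomial; thus the
  coefficientwise scaling is a differential operator with polynomial coefficients.\<close>

lemma fibre_deriv_Suc:
  "fibre_deriv (Suc a) c g =
    pmult (single (single 0 1) 1) (sderiv 0 (fibre_deriv a c g)) +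
    pmult (single (single 1 1) (- 1)) (sderiv 1 (fibre_deriv a c g)) +
    pmult (single 0 (- of_nat c - 1 - of_nat a)) (fibre_deriv a c g)"
proof
  fix m
  have 0: "mshift 0 (fibre_deriv a c g) m = fibre_deriv a c g m"
    using mshift_add_arg[of 0 "fibre_deriv a c g" m] by simp
  show "fibre_deriv (Suc a) c g m = (pmult (single (single 0 1) 1) (sderiv 0 (fibre_deriv a c g)) +
    pmult (single (single 1 1) (- 1)) (sderiv 1 (fibre_deriv a c g)) +
    pmult (single 0 (- of_nat c - 1 - of_nat a)) (fibre_deriv a c g)) m"
    unfolding plus_fun_apply pmult_single mshift_single_sderiv 0
    by (simp add: fibre_deriv_def algebra_simps)
qed

text \<open>Each of the \<open>a\<close> Euler factors costs one degree and one order of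
  derivation.\<close>

lemma fibre_deriv_in_pspan:
  assumes "g \<in> derivs I k f" "0 \<in> I" "1 \<in> I" "I \<subseteq> V"
  shows "fibre_deriv a c g \<in> pspan V a (derivs I (k + a) f)"
proof (induction a)
  case 0
  have "pmult 1 g \<in> pspan V 0 (derivs I k f)"
    using assms by (intro pspan_base) auto
  then show ?case by (simp add: fibre_deriv_def)
next
  case (Suc a)
  let ?g = "fibre_deriv a c g"
  have *: "pmult (single (single i 1) e) (sderiv i ?g) \<in> pspan V (a + 1) (derivs I (Suc (k + a)) f)"
    if "i \<in> I" for i e
    using Suc that assms by (intro pspan_pmult pspan_derivs_sderiv bounded_poly_single) auto
  have "pmult (single 0 e) ?g \<in> pspan V (a + 1) (derivs I (k + a) f)" for e
    using Suc by (intro pspan_pmult bounded_poly_single) auto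
  then have "pmult (single 0 e) ?g \<in> pspan V (a + 1) (derivs I (Suc (k + a)) f)" for e
    by (rule pspan_mono) (simp_all add: derivs_mono)
  then show ?case
    unfolding fibre_deriv_Suc add_Suc_right using * assms
    by (simp only: Suc_eq_plus1) (intro pspan_add, auto)
qed

subsection \<open>Diagonals\<close>

text \<open>Under x0 = s, x1 = t/s the exponent of s is the difference of the exponents of x0 and
  x1. Hence this is the coefficient of s^e in g(s, t/s, ...), and e = 0 gives the diagonal.\<close>

definition diagk :: "nat \<Rightarrow> 'a::zero mseries \<Rightarrow> 'a mseries" where
  "diagk e g = (\<lambda>m. if lookup m 0 = 0 then g (m + single 0 (lookup m 1 + e)) else 0)"

lemma diag21_eq_diagk: "diag21 f = diagk 0 f"
  by (simp add: diag21_def diagk_def fun_eq_iff)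

lemma diagk_plus: "diagk e (f + g) = diagk e f + diagk e (g :: 'a::comm_ring_1 mseries)"
  by (simp add: diagk_def fun_eq_iff)

lemma diagk_zero: "diagk e 0 = (0 :: 'a::comm_ring_1 mseries)"
  by (simp add: diagk_def fun_eq_iff)

lemma diagk_sum: "diagk e (\<Sum>x\<in>S. g x) = (\<Sum>x\<in>S. diagk e (g x :: 'a::comm_ring_1 mseries))"
  by (induction S rule: infinite_finite_induct) (simp_all only: sum.insert sum.empty sum.infinite
      diagk_plus diagk_zero simp_thms)

text \<open>The substitution \<open>t \<mapsto> x\<^sub>0 x\<^sub>1\<close>.\<close>

definition subst_monom :: "monom \<Rightarrow> monom" where
  "subst_monom a = a + single 0 (lookup a 1)"

definition subst_poly :: "'a::comm_ring_1 mpoly \<Rightarrow> 'a mpoly" where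
  "subst_poly c = (\<Sum>a\<in>keys c. single (subst_monom a) (lookup c a))"

lemma diagk_mshift:
  fixes g :: "'a::comm_ring_1 mseries"
  assumes a: "lookup a 0 = 0"
  shows "diagk e (mshift (subst_monom a) g) = mshift a (diagk e g)"
proof
  fix m
  show "diagk e (mshift (subst_monom a) g) m = mshift a (diagk e g) m"
  proof (rule mshift_cases[where ?'a = 'a, of m a])
    fix k assume k: "m = a + k" "\<And>f. mshift a f m = (f k :: 'a)"
    have "m + single 0 (lookup m 1 + e) = subst_monom a + (k + single 0 (lookup k 1 + e))"
      by (simp add: k(1) subst_monom_def lookup_add single_add ac_simps)
    then show ?thesis
      unfolding k(2) using k(1) a by (simp add: diagk_def lookup_add)
  next
    assume k: "\<And>k. m \<noteq> a + k" "\<And>f. mshift a f m = (0 :: 'a)"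
    have "mshift (subst_monom a) g (m + single 0 (lookup m 1 + e)) = 0"
    proof (rule mshift_eq_0)
      fix K
      show "m + single 0 (lookup m 1 + e) \<noteq> subst_monom a + K"
      proof
        assume *: "m + single 0 (lookup m 1 + e) = subst_monom a + K"
        have "lookup a v \<le> lookup m v" for v
        proof (cases "v = 0")
          case False
          have "lookup (m + single 0 (lookup m 1 + e)) v = lookup (subst_monom a + K) v"
            using * by simp
          then show ?thesis using False by (simp add: lookup_add subst_monom_def lookup_single)
        qed (simp add: a)
        then show False using k(1) monom_le_iff by blast
      qed
    qed
    then show ?thesis unfolding k(2) by (simp add: diagk_def)
  qed
qed

text \<open>Polynomials in t, x2, ... are free of s and therefore pull out of the extraction of a
  coefficient of s.\<close>

lemma diagk_pmult_subst:
  assumes "\<forall>a\<in>keys c. lookup a 0 = 0"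
  shows "diagk e (pmult (subst_poly c) g) = pmult c (diagk e g)"
proof -
  have 1: "diagk e (pmult (single (subst_monom a) x) g) = pmult (single a x) (diagk e g)"
    if "a \<in> keys c" for a x
  proof
    fix m
    have "diagk e (pmult (single (subst_monom a) x) g) m = x * diagk e (mshift (subst_monom a) g) m"
      by (simp add: pmult_single diagk_def)
    then show "diagk e (pmult (single (subst_monom a) x) g) m = pmult (single a x) (diagk e g) m"
      using diagk_mshift[of a e g] assms that by (simp add: pmult_single)
  qed
  have "diagk e (pmult (subst_poly c) g) = (\<Sum>a\<in>keys c. pmult (single a (lookup c a)) (diagk e g))"
    unfolding subst_poly_def pmult.scale_sum_left diagk_sum by (intro sum.cong 1) auto
  also have "\<dots> = pmult c (diagk e g)"
    unfolding pmult.scale_sum_left[symmetric] poly_mapping_eq_sum_single[symmetric] ..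
  finally show ?thesis .
qed

lemma diagk_mult_var0:
  "diagk (k + e) (pmult (single (single 0 k) 1) g) = diagk e (g :: 'a::comm_ring_1 mseries)"
proof
  fix m :: monom
  have "m + single 0 (lookup m 1 + (k + e)) = single 0 k + (m + single 0 (lookup m 1 + e))"
    by (simp add: single_add ac_simps)
  then show "diagk (k + e) (pmult (single (single 0 k) 1) g) m = diagk e g m"
    unfolding diagk_def pmult_single by simp
qed

text \<open>On the coefficient of s^e the difference of the two exponents is constantly
  \<open>e\<close>, so the Euler factors become scalars: those produced by the \<open>a\<close>-fold
  derivative of s^(e-c-1).\<close>

lemma diagk_fibre_deriv:
  "diagk e (fibre_deriv a c g) =
    pmult (single 0 (\<Prod>k<a. of_nat e - of_nat c - 1 - of_nat k)) (diagk e (g :: 'a::comm_ring_1 mseries))"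
proof
  fix m :: monom
  have "mshift 0 (diagk e g) m = diagk e g m" using mshift_add_arg[of 0 "diagk e g" m] by simp
  then show "diagk e (fibre_deriv a c g) m =
    pmult (single 0 (\<Prod>k<a. of_nat e - of_nat c - 1 - of_nat k)) (diagk e g) m"
    by (simp add: pmult_single diagk_def fibre_deriv_def lookup_add lookup_single)
qed

text \<open>The exponent of \<open>1/s\<close> in \<open>D\<^sub>t (g(s, t/s, \<dots>)) = s\<^sup>-\<^sup>1 (D\<^sub>1 g)(s, t/s, \<dots>)\<close>; the
  derivations \<open>D\<^sub>y\<close> with \<open>y \<ge> 2\<close> commute with the substitution.\<close>

definition twist :: "nat \<Rightarrow> nat" where
  "twist y = of_bool (y = 1)"

lemma diagk_sderiv:
  assumes "y \<noteq> 0"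
  shows "diagk (twist y + e) (sderiv y g) = sderiv y (diagk e g)"
proof
  fix m :: monom
  have "m + single 0 (lookup m 1 + (twist y + e)) + single y 1 =
    m + single y 1 + single 0 (lookup (m + single y 1) 1 + e)"
    by (auto simp: twist_def single_add lookup_add lookup_single ac_simps)
  then show "diagk (twist y + e) (sderiv y g) m = sderiv y (diagk e g) m"
    using assms by (simp add: diagk_def sderiv_def lookup_add lookup_single)
qed

lemma diagk_sderiv_funpow:
  assumes "y \<noteq> 0"
  shows "diagk (twist y * b) ((sderiv y ^^ b) g) = (sderiv y ^^ b) (diagk 0 g)"
proof (induction b)
  case (Suc b)
  then show ?case using diagk_sderiv[OF assms, of "twist y * b" "(sderiv y ^^ b) g"] by simp
qed simp

text \<open>A monomial of the extracted coefficient comes from one of \<open>p\<close> by deleting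
  its power of x0, so the support is finite and the degree cannot rise.\<close>

lemma ex_diagk_poly:
  assumes p: "bounded_poly V k (p :: 'a::zero mpoly)"
  shows "\<exists>p'. lookup p' = diagk e (lookup p) \<and> bounded_poly (V - {0}) k p'"
proof -
  let ?S = "(\<lambda>M. M - single 0 (lookup M 0)) ` keys p"
  have "finite ?S" by simp
  from ex_lookup_eq_on[OF this, of "diagk e (lookup p)"] obtain p'
    where p': "\<And>m. lookup p' m = (if m \<in> ?S then diagk e (lookup p) m else 0)" by blast
  have S: "m \<in> ?S" if "diagk e (lookup p) m \<noteq> 0" for m
  proof -
    let ?M = "m + single 0 (lookup m 1 + e)"
    from that have *: "lookup m 0 = 0" "?M \<in> keys p"
      by (auto simp: diagk_def in_keys_iff split: if_splits)
    have "m = ?M - single 0 (lookup ?M 0)"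
      using *(1) by (simp add: lookup_add)
    then show ?thesis by (rule image_eqI[OF _ *(2)])
  qed
  have eq: "lookup p' = diagk e (lookup p)"
  proof
    fix m
    show "lookup p' m = diagk e (lookup p) m" using S[of m] p'[of m] by presburger
  qed
  moreover have "bounded_poly (V - {0}) k p'"
    unfolding bounded_poly_def
  proof
    fix m assume "m \<in> keys p'"
    then have "lookup p' m \<noteq> 0" by (simp add: in_keys_iff)
    then have *: "lookup m 0 = 0" "m + single 0 (lookup m 1 + e) \<in> keys p"
      unfolding eq by (auto simp: diagk_def in_keys_iff split: if_splits)
    then have "keys (m + single 0 (lookup m 1 + e)) \<subseteq> V" "mdeg (m + single 0 (lookup m 1 + e)) \<le> k"
      using p unfolding bounded_poly_def by blast+
    then have "keys m \<subseteq> V" "mdeg m \<le> k" by auto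
    moreover have "0 \<notin> keys m" using *(1) by (simp add: in_keys_iff)
    ultimately show "keys m \<subseteq> V - {0} \<and> mdeg m \<le> k" by auto
  qed
  ultimately show ?thesis by blast
qed

text \<open>A contribution to s^e needs an exponent of x0 of at least \<open>e\<close>. Relations
  between polynomials thus need testing for finitely many \<open>e\<close> only.\<close>

lemma diagk_poly_eq_0:
  assumes "bounded_poly V k p" "k < e"
  shows "diagk e (lookup p) = (0 :: 'a::comm_ring_1 mseries)"
proof
  fix m
  have "m + single 0 (lookup m 1 + e) \<notin> keys p"
    using assms lookup_le_mdeg[of "m + single 0 (lookup m 1 + e)" 0]
    by (auto simp: bounded_poly_def lookup_add)
  then show "diagk e (lookup p) m = 0 m"
    by (simp add: diagk_def in_keys_iff)
qed

text \<open>No monomial acquires a negative power of s under x1 = t/s. As \<open>diagk\<close> sees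
  only nonnegative powers, this ensures that the extracted coefficients determine the
  polynomial.\<close>

definition fibre_regular :: "'a::zero mpoly \<Rightarrow> bool" where
  "fibre_regular p \<longleftrightarrow> (\<forall>m\<in>keys p. lookup m 1 \<le> lookup m 0)"

lemma fibre_regular_subst: "fibre_regular (subst_poly c)"
proof -
  have "fibre_regular (\<Sum>a\<in>S. single (subst_monom a) (g a :: 'a))" if "finite S" for S g
    using that
  proof (induction S rule: finite_induct)
    case (insert a S)
    then show ?case
      using Poly_Mapping.keys_add[of "single (subst_monom a) (g a)" "\<Sum>a\<in>S. single (subst_monom a) (g a)"]
      by (fastforce simp: fibre_regular_def subst_monom_def lookup_add lookup_single split: if_splits)
  qed (simp add: fibre_regular_def)
  then show ?thesis by (simp add: subst_poly_def)
qed

lemma fibre_regular_mult: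
  "fibre_regular p \<Longrightarrow> fibre_regular q \<Longrightarrow> fibre_regular (p * q :: 'a::comm_ring_1 mpoly)"
  using keys_mult[of p q] unfolding fibre_regular_def
  by (force simp: lookup_add intro!: add_mono dest!: subsetD)

lemma fibre_regular_sum:
  "(\<And>x. x \<in> S \<Longrightarrow> fibre_regular (p x)) \<Longrightarrow> fibre_regular (\<Sum>x\<in>S. p x :: 'a::comm_ring_1 mpoly)"
proof (induction S rule: infinite_finite_induct)
  case (insert x S)
  then show ?case
    using Poly_Mapping.keys_add[of "p x" "\<Sum>x\<in>S. p x"] by (auto simp: fibre_regular_def)
qed (simp_all add: fibre_regular_def)

text \<open>The exponent of x1 is at most the degree, so x0^k outweighs it.\<close>

lemma fibre_regular_mult_var0:
  assumes "bounded_poly V k p"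
  shows "fibre_regular (single (single 0 k) 1 * p :: 'a::comm_ring_1 mpoly)"
  unfolding fibre_regular_def
proof
  fix m assume "m \<in> keys (single (single 0 k) 1 * p)"
  then obtain b where b: "b \<in> keys p" "m = single 0 k + b"
    using keys_mult[of "single (single 0 k) 1" p] by (auto split: if_splits)
  have "lookup b 1 \<le> k"
    using assms b lookup_le_mdeg[of b 1] by (force simp: bounded_poly_def)
  then show "lookup m 1 \<le> lookup m 0"
    by (simp add: b lookup_add lookup_single)
qed

lemma fibre_regular_eq_0:
  assumes "fibre_regular p" "\<And>e. diagk e (lookup p) = (0 :: 'a::comm_ring_1 mseries)"
  shows "p = 0"
proof (rule poly_mapping_eqI, rule ccontr)
  fix M assume "lookup p M \<noteq> lookup 0 M"
  then have "lookup p M \<noteq> 0" by simp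
  then have le: "lookup M 1 \<le> lookup M 0"
    using assms(1) by (auto simp: fibre_regular_def in_keys_iff)
  define m where "m = M - single 0 (lookup M 0)"
  have "M = m + single 0 (lookup m 1 + (lookup M 0 - lookup M 1))"
    unfolding m_def using le
    by (intro poly_mapping_eqI) (auto simp: lookup_add lookup_minus lookup_single when_def)
  moreover have "lookup m 0 = 0" by (simp add: m_def lookup_minus)
  ultimately have "diagk (lookup M 0 - lookup M 1) (lookup p) m = lookup p M"
    by (simp add: diagk_def)
  then show False using assms(2) \<open>lookup p M \<noteq> 0\<close> by simp
qed

subsection \<open>Kernel vectors of small degree\<close>

lemma bounded_poly_det:
  assumes "M \<in> carrier_mat k k" "\<And>i j. i < k \<Longrightarrow> j < k \<Longrightarrow> bounded_poly V e (M $$ (i, j))"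
  shows "bounded_poly V (k * e) (det M :: 'a::comm_ring_1 mpoly)"
proof -
  have "bounded_poly V (k * e) (signof \<pi> * (\<Prod>i = 0..<k. M $$ (i, \<pi> i)))"
    if "\<pi> permutes {0..<k}" for \<pi>
  proof -
    have "\<pi> i < k" if "i < k" for i
      using permutes_in_image[OF \<open>\<pi> permutes {0..<k}\<close>, of i] that by simp
    then have "bounded_poly V (\<Sum>i = 0..<k. e) (\<Prod>i = 0..<k. M $$ (i, \<pi> i))"
      using assms(2) by (intro bounded_poly_prod) auto
    moreover have "bounded_poly V 0 (signof \<pi> :: 'a mpoly)"
      by (auto simp: sign_def intro: bounded_poly_uminus)
    ultimately show ?thesis
      using bounded_poly_mult[of V 0 "signof \<pi> :: 'a mpoly" "k * e"] by simp
  qed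
  then show ?thesis
    unfolding det_def'[OF assms(1)] by (intro bounded_poly_sum) auto
qed

text \<open>A kernel vector is read off the Laplace expansions of the vanishing minors that border a
  nonzero minor of maximal size.\<close>

lemma ex_bounded_kernel_vector:
  fixes A :: "'r \<Rightarrow> 'c \<Rightarrow> 'a::idom mpoly"
  assumes fin: "finite R" "finite C" and less: "card R < card C"
    and A: "\<And>r c. r \<in> R \<Longrightarrow> c \<in> C \<Longrightarrow> bounded_poly V e (A r c)"
  shows "\<exists>v. (\<exists>c\<in>C. v c \<noteq> 0) \<and> (\<forall>c. bounded_poly V (card R * e) (v c)) \<and>
    (\<forall>r\<in>R. (\<Sum>c\<in>C. A r c * v c) = 0)"
proof -
  define sub where "sub ri ci k = mat k k (\<lambda>(i, j). A (ri i) (ci j))" for ri :: "nat \<Rightarrow> 'r" and ci :: "nat \<Rightarrow> 'c" and k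
  have sub_carrier: "sub ri ci k \<in> carrier_mat k k" for ri ci k
    by (simp add: sub_def)
  \<comment> \<open>Rows and columns are chosen by functions that may repeat; this is harmless,
    since a repetition makes the minor vanish.\<close>
  define P where "P k \<longleftrightarrow> (\<exists>ri ci. (\<forall>i<k. ri i \<in> R \<and> ci i \<in> C) \<and> det (sub ri ci k) \<noteq> 0)" for k
  have P_le: "k \<le> card R" if "P k" for k
  proof (rule ccontr)
    assume "\<not> k \<le> card R"
    from \<open>P k\<close> obtain ri ci where *: "\<forall>i<k. ri i \<in> R \<and> ci i \<in> C" "det (sub ri ci k) \<noteq> 0"
      by (auto simp: P_def)
    have "ri ` {..<k} \<subseteq> R" using * by auto
    then have "card (ri ` {..<k}) \<le> card R" by (rule card_mono[OF fin(1)])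
    then have "card (ri ` {..<k}) < card {..<k}"
      using \<open>\<not> k \<le> card R\<close> by simp
    then have "\<not> inj_on ri {..<k}" by (rule pigeonhole)
    then obtain i j where ij: "i < k" "j < k" "i \<noteq> j" "ri i = ri j"
      unfolding inj_on_def lessThan_iff by blast
    then have "row (sub ri ci k) i = row (sub ri ci k) j"
      by (intro eq_vecI) (auto simp: sub_def)
    then have "det (sub ri ci k) = 0"
      by (rule det_identical_rows[OF sub_carrier ij(3,1,2)])
    with * show False by simp
  qed
  have "P 0" by (simp add: P_def sub_def)
  define k where "k = (GREATEST k. P k)"
  have "P k" unfolding k_def using \<open>P 0\<close> P_le by (rule GreatestI_nat)
  have notP: "\<not> P (Suc k)"
    using Greatest_le_nat[of P "Suc k" "card R"] P_le by (auto simp: k_def)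
  from \<open>P k\<close> obtain ri ci where rc: "\<And>i. i < k \<Longrightarrow> ri i \<in> R" "\<And>i. i < k \<Longrightarrow> ci i \<in> C"
    and det: "det (sub ri ci k) \<noteq> 0"
    by (auto simp: P_def)
  have "card (ci ` {..<k}) < card C"
    using card_image_le[of "{..<k}" ci] P_le[OF \<open>P k\<close>] less by simp
  then have "\<not> C \<subseteq> ci ` {..<k}"
    using card_mono[of "ci ` {..<k}" C] by auto
  then obtain c0 where c0: "c0 \<in> C" "c0 \<notin> ci ` {..<k}" by auto
  define ci' where "ci' = ci(k := c0)"
  have ci': "ci' j \<in> C" if "j < Suc k" for j
    using that rc(2) c0(1) by (auto simp: ci'_def less_Suc_eq)
  \<comment> \<open>Whatever row is adjoined below, these are the cofactors of its entries once
    column \<open>c0\<close> is added; \<open>w k\<close> is the nonzero maximal minor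
    itself.\<close>
  define w where "w j = (- 1) ^ (k + j) * det (sub ri (\<lambda>j'. ci' (if j' < j then j' else Suc j')) k)" for j
  have w: "bounded_poly V (card R * e) (w j)" if j: "j < Suc k" for j
  proof -
    have "bounded_poly V (k * e) (det (sub ri (\<lambda>j'. ci' (if j' < j then j' else Suc j')) k))"
      by (rule bounded_poly_det[OF sub_carrier]) (use j in \<open>auto simp: sub_def intro!: A rc ci'\<close>)
    moreover have "bounded_poly V 0 ((- 1) ^ (k + j) :: 'a mpoly)"
      using bounded_poly_power[of V 0 "- 1 :: 'a mpoly" "k + j"] by (simp add: bounded_poly_uminus)
    ultimately have "bounded_poly V (0 + k * e) (w j)"
      unfolding w_def by (intro bounded_poly_mult)
    then show ?thesis
      by (rule bounded_poly_mono) (use P_le[OF \<open>P k\<close>] in simp)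
  qed
  \<comment> \<open>Summing over all positions of a column spares a proof that \<open>ci'\<close> is
    injective.\<close>
  define v where "v c = (\<Sum>j\<in>{j. j < Suc k \<and> ci' j = c}. w j)" for c
  have "v c0 = w k"
  proof -
    have "{j. j < Suc k \<and> ci' j = c0} = {k}"
      using c0(2) by (auto simp: ci'_def less_Suc_eq)
    then show ?thesis by (simp add: v_def)
  qed
  moreover have "w k \<noteq> 0"
  proof -
    have "sub ri (\<lambda>j'. ci' (if j' < k then j' else Suc j')) k = sub ri ci k"
      by (rule eq_matI) (auto simp: sub_def ci'_def)
    then show ?thesis using det by (simp add: w_def)
  qed
  moreover have "bounded_poly V (card R * e) (v c)" for c
    unfolding v_def by (intro bounded_poly_sum w) auto
  moreover have "(\<Sum>c\<in>C. A r c * v c) = 0" if r: "r \<in> R" for r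
  proof -
    \<comment> \<open>Row \<open>r\<close> is adjoined at the bottom. The wanted sum expands this
      minor along its last row, and the minor vanishes by maximality of \<open>k\<close>.\<close>
    let ?M = "sub (ri(k := r)) ci' (Suc k)"
    have "(\<Sum>c\<in>C. A r c * v c) = (\<Sum>c\<in>C. \<Sum>j\<in>{j. j \<in> {..<Suc k} \<and> ci' j = c}. A r (ci' j) * w j)"
      unfolding v_def by (simp add: sum_distrib_left)
    also have "\<dots> = (\<Sum>j<Suc k. A r (ci' j) * w j)"
      by (rule sum.group) (use fin ci' in auto)
    also have "\<dots> = (\<Sum>j<Suc k. ?M $$ (k, j) * cofactor ?M k j)"
    proof (rule sum.cong)
      fix j assume j: "j \<in> {..<Suc k}"
      have "mat_delete ?M k j = sub ri (\<lambda>j'. ci' (if j' < j then j' else Suc j')) k"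
        by (rule eq_matI) (use j in \<open>auto simp: mat_delete_def sub_def\<close>)
      then show "A r (ci' j) * w j = ?M $$ (k, j) * cofactor ?M k j"
        using j by (simp add: cofactor_def w_def sub_def)
    qed simp
    also have "\<dots> = det ?M"
      by (rule laplace_expansion_row[OF sub_carrier, symmetric]) simp
    also have "\<dots> = 0"
    proof (rule ccontr)
      assume "det ?M \<noteq> 0"
      moreover have "\<forall>i<Suc k. (ri(k := r)) i \<in> R \<and> ci' i \<in> C"
        using rc(1) r ci' by (auto simp: less_Suc_eq)
      ultimately show False using notP unfolding P_def by blast
    qed
    finally show ?thesis .
  qed
  ultimately show ?thesis using c0(1) by metis
qed

section \<open>Operators as finite sums, and the number of unknowns\<close>

lemma sum_fun_apply: "(\<Sum>x\<in>S. g x) m = (\<Sum>x\<in>S. (g x m :: 'a::comm_ring_1))"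
  by (induction S rule: infinite_finite_induct) simp_all

lemma lookup_sum_fun: "lookup (\<Sum>x\<in>S. p x) = (\<Sum>x\<in>S. lookup (p x :: 'a::comm_ring_1 mpoly))"
  by (rule ext) (simp add: lookup_sum sum_fun_apply)

lemma dop_apply_superset:
  assumes "finite S" "keys P \<subseteq> S"
  shows "dop_apply y P f = (\<Sum>j\<in>S. pmult (lookup P j) ((sderiv y ^^ j) f))"
proof
  fix m
  have "dop_apply y P f m = (\<Sum>j\<in>keys P. pmult (lookup P j) ((sderiv y ^^ j) f) m)"
    by (simp add: dop_apply_def)
  also have "\<dots> = (\<Sum>j\<in>S. pmult (lookup P j) ((sderiv y ^^ j) f) m)"
    using assms by (intro sum.mono_neutral_left) (auto simp: in_keys_iff pmult_0_left)
  finally show "dop_apply y P f m = (\<Sum>j\<in>S. pmult (lookup P j) ((sderiv y ^^ j) f)) m"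
    by (simp add: sum_fun_apply)
qed

lemma bounded_poly_lookup_dop:
  assumes "dop_in V P"
  shows "bounded_poly V (dop_deg P) (lookup P j)"
proof (cases "j \<in> keys P")
  case True
  then have "tdeg (lookup P j) \<le> dop_deg P" unfolding dop_deg_def by (intro Max_ge) auto
  then show ?thesis using assms by (simp add: bounded_poly_iff dop_in_def)
qed (simp add: in_keys_iff)

text \<open>Stated for twice the cardinality to avoid a division.\<close>

lemma two_card_triangle: "2 * card (Sigma {..N} (\<lambda>a. {..N - a})) = (N + 1) * (N + 2)"
proof -
  have "card (Sigma {..N} (\<lambda>a. {..N - a})) = (\<Sum>a\<le>N. Suc (N - a))"
    by (subst card_SigmaI) auto
  also have "\<dots> = (\<Sum>a\<le>N. Suc a)"
    by (rule sum.reindex_bij_witness[of _ "\<lambda>a. N - a" "\<lambda>a. N - a"]) auto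
  also have "2 * \<dots> = (N + 1) * (N + 2)"
    by (induction N) auto
  finally show ?thesis .
qed

subsection \<open>Annihilating the diagonal\<close>

text \<open>The argument of \<open>diagk\<close> is s^(N+1) D_s^a D_y^b F with F = s^(-1) f(s, t/s,
  ...), so the left side is the residue of s^k0 D_s^a D_y^b F. Integration by parts moves D_s^a onto
  s^k0: nothing survives for a > k0, and a = k0 leaves the factor (-1)^k0 k0!.\<close>

lemma fibre_term_diagonal:
  fixes f :: "'a::field_char_0 mseries"
  assumes y: "y \<noteq> 0" and ab: "a + b \<le> N" and k0: "k0 \<le> a"
  shows "diagk (N - k0) (pmult (single (single 0 (N - a - twist y * b)) 1)
      (fibre_deriv a (twist y * b) (mderiv (single y b) f))) =
    (if a = k0 then pmult (single 0 (\<Prod>k<k0. - 1 - of_nat k)) ((sderiv y ^^ b) (diagk 0 f)) else 0)"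
proof -
  let ?e = "twist y * b"
  have le: "?e \<le> b" by (simp add: twist_def)
  have N: "N - k0 = (N - a - ?e) + (a - k0 + ?e)" using ab k0 le by linarith
  have "diagk (N - k0) (pmult (single (single 0 (N - a - ?e)) 1)
      (fibre_deriv a ?e (mderiv (single y b) f))) =
    pmult (single 0 (\<Prod>k<a. of_nat (a - k0) - 1 - of_nat k)) (diagk (a - k0 + ?e) (mderiv (single y b) f))"
    unfolding N diagk_mult_var0 diagk_fibre_deriv of_nat_add by simp
  \<comment> \<open>For \<open>a > k0\<close> the factor with index \<open>a - k0 - 1\<close> is
    zero.\<close>
  moreover have "(\<Prod>k<a. of_nat (a - k0) - 1 - of_nat k) = (0 :: 'a)" if "a \<noteq> k0"
  proof (intro prod_zero bexI[of _ "a - k0 - 1"])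
    have "a - k0 = Suc (a - k0 - 1)" using that k0 by simp
    then show "of_nat (a - k0) - 1 - of_nat (a - k0 - 1) = (0 :: 'a)"
      by (metis add_diff_cancel_left' diff_self of_nat_Suc)
  qed (use that k0 in auto)
  moreover have "diagk ?e (mderiv (single y b) f) = (sderiv y ^^ b) (diagk 0 f)"
    unfolding sderiv_funpow_eq_mderiv[symmetric] by (rule diagk_sderiv_funpow[OF y])
  ultimately show ?thesis
    by (cases "a = k0") (simp_all only: if_True if_False single_zero pmult.scale_zero_left
        diff_self_eq_0 of_nat_0 add_0 diff_0 simp_thms)
qed

text \<open>As a set, \<open>I\<close> collapses to two elements for \<open>y = 1\<close>, so one
  argument serves D_t, with two operators, and the other derivations, with three.\<close>

lemma diagonal_annihilator:
  fixes f :: "'a::field_char_0 mseries" and L :: "nat \<Rightarrow> 'a dop" and y :: nat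
  defines "I \<equiv> {0, 1, y}"
  defines "M \<equiv> \<Prod>i\<in>I. dop_ord (L i)" and "D \<equiv> (\<Sum>i\<in>I. dop_deg (L i)) + 1"
  assumes y: "y \<noteq> 0" and I: "I \<subseteq> {..<n}"
    and L_in: "\<And>i. i \<in> I \<Longrightarrow> dop_in {..<n} (L i)"
    and L_nz: "\<And>i. i \<in> I \<Longrightarrow> L i \<noteq> 0"
    and L_ann: "\<And>i. i \<in> I \<Longrightarrow> dop_apply i (L i) f = 0"
  shows "\<exists>P :: 'a dop. P \<noteq> 0 \<and> dop_in {1..<n} P \<and> dop_apply y P (diag21 f) = 0 \<and>
    dop_deg P \<le> 8 * D\<^sup>2 * M\<^sup>2 * (8 * D\<^sup>2 * M + 1) \<and> dop_ord P \<le> 4 * D * M"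
proof -
  let ?V = "{..<n}"
  define r where "r i = dop_ord (L i)" for i
  define d where "d i = dop_deg (L i)" for i
  define l where "l i j = lookup (L i) j" for i j
  have finI: "finite I" by (simp add: I_def)
  have l: "bounded_poly ?V (d i) (l i j)" if "i \<in> I" for i j
    unfolding l_def d_def by (rule bounded_poly_lookup_dop[OF L_in[OF that]])
  have keysL: "keys (L i) \<subseteq> {..r i}" for i
    unfolding r_def dop_ord_def by auto
  have lr: "l i (r i) \<noteq> 0" if "i \<in> I" for i
  proof -
    have "keys (L i) \<noteq> {}" using L_nz[OF that] by (metis all_not_in_conv in_keys_iff lookup_zero poly_mapping_eqI)
    then have "r i \<in> keys (L i)" unfolding r_def dop_ord_def by (intro Max_in) auto
    then show ?thesis by (simp add: l_def in_keys_iff)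
  qed
  have eqs: "(\<Sum>j\<le>r i. pmult (l i j) (mderiv (single i j) f)) = 0" if "i \<in> I" for i
    using L_ann[OF that] unfolding dop_apply_superset[OF finite_atMost keysL] l_def
      sderiv_funpow_eq_mderiv .
  show ?thesis
  proof (cases "M = 0")
    \<comment> \<open>Some operator has order 0, so it multiplies by a nonzero polynomial. Then
      \<open>f = 0\<close>, and the operator 1 meets the bounds, which are zero here.\<close>
    case True
    then obtain i where i: "i \<in> I" "r i = 0" using finI by (auto simp: M_def r_def)
    then have "pmult (l i 0) f = 0" using eqs[OF i(1)] by simp
    then have f0: "f = 0" using lr[OF i(1)] i(2) pmult_eq_0_imp by metis
    let ?P = "single 0 1 :: 'a dop"
    have "dop_apply y ?P (diag21 f) = 0"
      unfolding f0 diag21_eq_diagk diagk_zero dop_apply_superset[OF finite_keys subset_refl]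
        sderiv_funpow_eq_mderiv mderiv_zero pmult.scale_zero_right by (rule sum.neutral_const)
    moreover have "tdeg (1 :: 'a mpoly) = 0" "poly_in {1..<n} (1 :: 'a mpoly)"
      by (simp_all add: tdeg_def poly_in_def monom_in_def)
    then have "dop_in {1..<n} ?P" "dop_deg ?P = 0" "dop_ord ?P = 0"
      by (auto simp: dop_in_def dop_deg_def dop_ord_def lookup_one when_def poly_in_def)
    moreover have "?P \<noteq> 0" by (metis lookup_single_eq lookup_zero zero_neq_one)
    ultimately show ?thesis by (intro exI[of _ ?P]) simp
  next
    case False
    then have r_pos: "0 < r i" if "i \<in> I" for i using that finI by (auto simp: M_def r_def)
    define q where "q = (\<Prod>i\<in>I. l i (r i))"
    have "q \<noteq> 0" unfolding q_def using finI lr by simp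
    define N where "N = 4 * D * M"
    define S where "S = Sigma {..N} (\<lambda>a. {..N - a})"
    have finS: "finite S" by (simp add: S_def)
    have S_le: "fst s + snd s \<le> N" if "s \<in> S" for s using that by (auto simp: S_def)
    define B where "B = box_derivs I r f"
    have finB: "finite B" and cardB: "card B \<le> M"
    proof -
      show "finite B" unfolding B_def box_derivs_def using finite_monom_box[OF finI] by blast
      show "card B \<le> M" unfolding B_def box_derivs_def M_def r_def[symmetric]
        using card_image_le[OF finite_monom_box[OF finI]] card_monom_box[OF finI] le_trans by blast
    qed
    \<comment> \<open>At the pair (a, b) this is s^(N+1) D_s^a D_y^b F, written in the original
      variables x0 and x1.\<close>
    define G where "G s = pmult (single (single 0 (N - fst s - twist y * snd s)) 1)
      (fibre_deriv (fst s) (twist y * snd s) (mderiv (single y (snd s)) f))" for s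
    have "\<forall>s\<in>S. \<exists>p. (\<forall>b. bounded_poly ?V (N * D) (p b)) \<and> pmult (q ^ N) (G s) = (\<Sum>b\<in>B. pmult (p b) b)"
    proof
      fix s assume "s \<in> S"
      then have s: "fst s + snd s \<le> N" by (rule S_le)
      have tw: "twist y * snd s \<le> snd s" by (simp add: twist_def)
      have "mderiv (single y (snd s)) f \<in> derivs I (Suc (snd s)) f"
        by (rule mderiv_in_derivs) (auto simp: I_def)
      then have "fibre_deriv (fst s) (twist y * snd s) (mderiv (single y (snd s)) f)
          \<in> pspan ?V (fst s) (derivs I (Suc (snd s) + fst s) f)"
        by (rule fibre_deriv_in_pspan) (use I in \<open>simp_all add: I_def\<close>)
      then have "G s \<in> pspan ?V (fst s + (N - fst s - twist y * snd s)) (derivs I (Suc (snd s) + fst s) f)"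
        unfolding G_def using I by (intro pspan_pmult bounded_poly_single) (auto simp: I_def)
      then have "G s \<in> pspan ?V N (derivs I (Suc N) f)"
        by (rule pspan_mono) (use s tw in \<open>auto intro!: derivs_mono\<close>)
      then have "pmult (q ^ N) (G s) \<in> pspan ?V (N + N * (\<Sum>i\<in>I. d i)) B"
      proof (rule pspan_pmult_trans)
        fix b assume "b \<in> derivs I (Suc N) f"
        then obtain a where a: "b = mderiv a f" "keys a \<subseteq> I" "mdeg a \<le> N"
          by (auto simp: derivs_def)
        show "pmult (q ^ N) b \<in> pspan ?V (N * (\<Sum>i\<in>I. d i)) B"
          unfolding a(1) q_def B_def
          by (rule pmult_power_mderiv_in_pspan[OF finI l eqs r_pos a(2,3)])
      qed
      \<comment> \<open>The summand 1 in \<open>D\<close> pays for the power of x0 and the Euler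
        factors, which together have degree at most \<open>N\<close>.\<close>
      also have "N + N * (\<Sum>i\<in>I. d i) = N * D" by (simp add: D_def d_def)
      finally obtain p where "\<And>b. bounded_poly ?V (N * D) (p b)"
        "pmult (q ^ N) (G s) = (\<Sum>b\<in>B. pmult (p b) b)"
        using pspan_finiteE[OF _ finB] by blast
      then show "\<exists>p. (\<forall>b. bounded_poly ?V (N * D) (p b)) \<and> pmult (q ^ N) (G s) = (\<Sum>b\<in>B. pmult (p b) b)"
        by blast
    qed
    from bchoice[OF this] obtain p where p: "\<And>s b. s \<in> S \<Longrightarrow> bounded_poly ?V (N * D) (p s b)"
      "\<And>s. s \<in> S \<Longrightarrow> pmult (q ^ N) (G s) = (\<Sum>b\<in>B. pmult (p s b) b)"
      by blast

    text \<open>Multiplying by \<open>x\<^sub>0\<^bsup>ND\<^esup>\<close> removes the negative powers of \<open>s\<close> that \<open>x\<^sub>1 = t/s\<close> produces.\<close>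

    define z where "z = (single (single 0 (N * D)) 1 :: 'a mpoly)"
    define p' where "p' s b = z * p s b" for s b
    let ?K = "2 * N * D"
    have p': "bounded_poly ?V ?K (p' s b)" "fibre_regular (p' s b)" if "s \<in> S" for s b
    proof -
      have "bounded_poly ?V (N * D + N * D) (p' s b)"
        unfolding p'_def z_def using I
        by (intro bounded_poly_mult p(1)[OF that] bounded_poly_single) (auto simp: I_def)
      then show "bounded_poly ?V ?K (p' s b)" by (simp add: mult_2 distrib_right)
      show "fibre_regular (p' s b)"
        unfolding p'_def z_def by (rule fibre_regular_mult_var0[OF p(1)[OF that]])
    qed
    \<comment> \<open>Entries of the linear system: a row is a base derivative together with an
      exponent of s, a column is a pair (a, b).\<close>
    define A where "A x s = (SOME p''. lookup p'' = diagk (snd x) (lookup (p' s (fst x))) \<and>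
      bounded_poly (?V - {0}) ?K p'')" for x s
    have A: "lookup (A x s) = diagk (snd x) (lookup (p' s (fst x)))" "bounded_poly (?V - {0}) ?K (A x s)"
      if "s \<in> S" for x s
      using someI_ex[OF ex_diagk_poly[OF p'(1)[OF that]]] unfolding A_def by blast+
    define R where "R = B \<times> {..?K}"
    have finR: "finite R" using finB by (simp add: R_def)
    have cardR: "card R \<le> M * (?K + 1)"
      unfolding R_def card_cartesian_product by (intro mult_le_mono cardB) simp
    \<comment> \<open>The choice N = 4DM turns 2M(2ND + 1) into N^2 + 2M, which stays below (N +
      1)(N + 2), twice the number of unknowns.\<close>
    have "2 * card R < 2 * card S"
    proof -
      have "2 * card R \<le> 2 * (M * (?K + 1))" by (rule mult_le_mono2[OF cardR])
      also have "\<dots> = 2 * M + N * N" by (simp add: N_def algebra_simps)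
      also have "2 * M \<le> N" by (simp add: N_def D_def)
      also have "N + N * N < (N + 1) * (N + 2)" by (simp add: algebra_simps)
      finally show ?thesis unfolding S_def two_card_triangle by simp
    qed
    then have "card R < card S" by simp
    then have "\<exists>v. (\<exists>s\<in>S. v s \<noteq> 0) \<and> (\<forall>s. bounded_poly (?V - {0}) (card R * ?K) (v s)) \<and>
      (\<forall>x\<in>R. (\<Sum>s\<in>S. A x s * v s) = 0)"
      by (rule ex_bounded_kernel_vector[OF finR finS]) (rule A(2))
    then obtain v where
      v_nz: "\<exists>s\<in>S. v s \<noteq> 0" and v: "\<And>s. bounded_poly (?V - {0}) (card R * ?K) (v s)"
      and ker: "\<And>x. x \<in> R \<Longrightarrow> (\<Sum>s\<in>S. A x s * v s) = 0"
      by (elim exE conjE) (rule that, auto)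
    have v0: "\<forall>a\<in>keys (v s). lookup a 0 = 0" for s
    proof
      fix a assume "a \<in> keys (v s)"
      then have "keys a \<subseteq> ?V - {0}" using v[of s] unfolding bounded_poly_def by blast
      then have "0 \<notin> keys a" by blast
      then show "lookup a 0 = 0" by (simp add: in_keys_iff)
    qed
    \<comment> \<open>Fibre regularity reduces this to coefficients of s^e: for \<open>e\<close> up
      to \<open>2 * N * D\<close> they vanish by the linear system, beyond that by degree.\<close>
    have X: "(\<Sum>s\<in>S. subst_poly (v s) * p' s b) = 0" if b: "b \<in> B" for b
    proof (rule fibre_regular_eq_0)
      show "fibre_regular (\<Sum>s\<in>S. subst_poly (v s) * p' s b)"
        by (intro fibre_regular_sum fibre_regular_mult fibre_regular_subst p')
      fix e
      have *: "diagk e (lookup (\<Sum>s\<in>S. subst_poly (v s) * p' s b)) =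
        (\<Sum>s\<in>S. pmult (v s) (diagk e (lookup (p' s b))))"
        unfolding lookup_sum_fun lookup_mult_eq_pmult diagk_sum diagk_pmult_subst[OF v0] ..
      show "diagk e (lookup (\<Sum>s\<in>S. subst_poly (v s) * p' s b)) = 0"
      proof (cases "e \<le> ?K")
        case True
        then have "(b, e) \<in> R" using b by (simp add: R_def)
        from ker[OF this] have "(\<Sum>s\<in>S. v s * A (b, e) s) = 0" by (simp only: mult.commute)
        then have "lookup (\<Sum>s\<in>S. v s * A (b, e) s) = 0" by (simp add: fun_eq_iff)
        moreover have "lookup (\<Sum>s\<in>S. v s * A (b, e) s) = (\<Sum>s\<in>S. pmult (v s) (diagk e (lookup (p' s b))))"
          unfolding lookup_sum_fun lookup_mult_eq_pmult by (intro sum.cong) (simp_all add: A(1))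
        ultimately show ?thesis unfolding * by simp
      next
        case False
        have "pmult (v s) (diagk e (lookup (p' s b))) = 0" if "s \<in> S" for s
          using diagk_poly_eq_0[OF p'(1)[OF that]] False pmult.scale_zero_right
          by (metis not_le)
        then show ?thesis unfolding * by (rule sum.neutral[OF ballI])
      qed
    qed
    define Z where "Z = (\<Sum>s\<in>S. pmult (subst_poly (v s)) (G s))"
    \<comment> \<open>Expanding over the base derivatives gives the sums just shown to vanish;
      absence of torsion then removes the denominator \<open>z * q ^ N\<close>.\<close>
    have "pmult (z * q ^ N) Z = (\<Sum>s\<in>S. pmult (subst_poly (v s)) (pmult z (pmult (q ^ N) (G s))))"
      unfolding Z_def pmult.scale_sum_right pmult_mult[symmetric] by (simp only: mult.commute mult.left_commute)
    also have "\<dots> = (\<Sum>s\<in>S. \<Sum>b\<in>B. pmult (subst_poly (v s) * p' s b) b)"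
      by (intro sum.cong refl) (simp only: p(2) pmult.scale_sum_right pmult_mult p'_def)
    also have "\<dots> = (\<Sum>b\<in>B. pmult (\<Sum>s\<in>S. subst_poly (v s) * p' s b) b)"
      unfolding pmult.scale_sum_left by (rule sum.swap)
    also have "\<dots> = 0"
      by (intro sum.neutral ballI) (simp only: X pmult.scale_zero_left)
    finally have "pmult (z * q ^ N) Z = 0" .
    moreover have "z \<noteq> 0" unfolding z_def by (metis lookup_single_eq lookup_zero zero_neq_one)
    then have "z * q ^ N \<noteq> 0" using \<open>q \<noteq> 0\<close> by simp
    ultimately have "Z = 0" using pmult_eq_0_imp by blast

    define k0 where "k0 = (LEAST a. \<exists>b. (a, b) \<in> S \<and> v (a, b) \<noteq> 0)"
    have "\<exists>b. (k0, b) \<in> S \<and> v (k0, b) \<noteq> 0"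
      unfolding k0_def using v_nz by - (rule LeastI_ex, force)
    then obtain b0 where b0: "(k0, b0) \<in> S" "v (k0, b0) \<noteq> 0" by blast
    have v_less: "v (a, b) = 0" if "(a, b) \<in> S" "a < k0" for a b
      using not_less_Least[of a "\<lambda>a. \<exists>b. (a, b) \<in> S \<and> v (a, b) \<noteq> 0"] that
      unfolding k0_def by blast
    \<comment> \<open>This is (-1)^k0 k0!, nonzero in characteristic 0.\<close>
    define \<kappa> where "\<kappa> = (\<Prod>k<k0. - 1 - of_nat k :: 'a)"
    have "- 1 - of_nat k \<noteq> (0 :: 'a)" for k
      by (metis add.commute diff_minus_eq_add minus_diff_eq neg_equal_0_iff_equal of_nat_Suc of_nat_neq_0)
    then have "\<kappa> \<noteq> 0" by (simp add: \<kappa>_def)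
    let ?g = "\<lambda>b. (sderiv y ^^ b) (diagk 0 f)"
    have summand: "pmult (v (a, b)) (diagk (N - k0) (G (a, b))) =
      (if a = k0 then pmult (single 0 \<kappa>) (pmult (v (a, b)) (?g b)) else 0)"
      if s: "(a, b) \<in> S" for a b
    proof (cases "a < k0")
      case True
      then show ?thesis using v_less[OF s] by (simp add: pmult_0_left)
    next
      case False
      then have "diagk (N - k0) (G (a, b)) = (if a = k0 then pmult (single 0 \<kappa>) (?g b) else 0)"
        using fibre_term_diagonal[OF y, of a b N k0 f] S_le[OF s] by (simp add: G_def \<kappa>_def)
      then show ?thesis
        using pmult.scale_left_commute pmult.scale_zero_right by metis
    qed
    \<comment> \<open>Extracting s^(N - k0) takes the residue of s^k0 times the relation: lower
      orders in D_s are absent by minimality of \<open>k0\<close>, higher ones have residue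
      zero.\<close>
    have "0 = diagk (N - k0) Z" unfolding \<open>Z = 0\<close> diagk_zero ..
    also have "\<dots> = (\<Sum>s\<in>S. pmult (v s) (diagk (N - k0) (G s)))"
      unfolding Z_def diagk_sum diagk_pmult_subst[OF v0] ..
    also have "\<dots> = (\<Sum>a\<le>N. \<Sum>b\<le>N - a. pmult (v (a, b)) (diagk (N - k0) (G (a, b))))"
      unfolding S_def by (subst sum.Sigma) (auto intro!: sum.cong)
    also have "\<dots> = (\<Sum>a\<in>{k0}. \<Sum>b\<le>N - a. pmult (v (a, b)) (diagk (N - k0) (G (a, b))))"
    proof (rule sum.mono_neutral_right)
      show "{k0} \<subseteq> {..N}" using b0(1) by (simp add: S_def)
      show "\<forall>a\<in>{..N} - {k0}. (\<Sum>b\<le>N - a. pmult (v (a, b)) (diagk (N - k0) (G (a, b)))) = 0"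
        by (intro ballI sum.neutral) (simp add: summand S_def)
    qed simp
    also have "\<dots> = (\<Sum>b\<le>N - k0. pmult (single 0 \<kappa>) (pmult (v (k0, b)) (?g b)))"
      using b0(1) by (auto simp: summand S_def intro!: sum.cong)
    also have "\<dots> = pmult (single 0 \<kappa>) (\<Sum>b\<le>N - k0. pmult (v (k0, b)) (?g b))"
      by (rule pmult.scale_sum_right[symmetric])
    finally have "pmult (single 0 \<kappa>) (\<Sum>b\<le>N - k0. pmult (v (k0, b)) (?g b)) = 0" ..
    moreover have "(single 0 \<kappa> :: 'a mpoly) \<noteq> 0" using \<open>\<kappa> \<noteq> 0\<close> by (metis lookup_single_eq lookup_zero)
    ultimately have ann: "(\<Sum>b\<le>N - k0. pmult (v (k0, b)) (?g b)) = 0" using pmult_eq_0_imp by blast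

    obtain P :: "'a dop" where P: "\<And>b. lookup P b = (if b \<in> {..N - k0} then v (k0, b) else 0)"
      using ex_lookup_eq_on[of "{..N - k0}" "\<lambda>b. v (k0, b)"] by blast
    have keysP: "keys P \<subseteq> {..N - k0}" by (auto simp: in_keys_iff P split: if_splits)
    have "lookup P b0 \<noteq> 0" using b0 by (simp add: P S_def)
    then have "P \<noteq> 0" "keys P \<noteq> {}" by (auto simp: in_keys_iff)
    have bP: "bounded_poly (?V - {0}) (card R * ?K) (lookup P b)" for b
      using v by (simp add: P)
    have "dop_in {1..<n} P"
    proof -
      have "?V - {0} = {1..<n}" by auto
      then show ?thesis using bP by (simp add: dop_in_def bounded_poly_iff)
    qed
    moreover have "dop_apply y P (diag21 f) = 0"
      unfolding dop_apply_superset[OF finite_atMost keysP] diag21_eq_diagk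
      using ann by (simp add: P)
    moreover have "dop_deg P \<le> 8 * D\<^sup>2 * M\<^sup>2 * (8 * D\<^sup>2 * M + 1)"
    proof -
      have "dop_deg P \<le> card R * ?K"
        unfolding dop_deg_def using bP by (auto simp: bounded_poly_iff)
      also have "\<dots> \<le> M * (?K + 1) * ?K" by (rule mult_le_mono1[OF cardR])
      also have "\<dots> = 8 * D\<^sup>2 * M\<^sup>2 * (8 * D\<^sup>2 * M + 1)"
        by (simp add: N_def power2_eq_square algebra_simps)
      finally show ?thesis .
    qed
    moreover have "dop_ord P \<le> N"
      unfolding dop_ord_def using keysP \<open>keys P \<noteq> {}\<close> by (subst Max_le_iff) auto
    ultimately show ?thesis using \<open>P \<noteq> 0\<close> by (auto simp: N_def)
  qed
qed

section \<open>Specialisation to D_t and to the remaining derivations\<close>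

theorem theorem4p2:
  fixes f :: "'a::field_char_0 mseries"
    and n :: nat
    and L :: "nat \<Rightarrow> 'a dop"
    and r d :: "nat \<Rightarrow> nat"
  assumes n2: "n \<ge> 2"
    and f_in: "series_in {..<n} f"
    and f_df: "dfinite n f"
    and L_in: "\<forall>i<n. dop_in {..<n} (L i)"
    and L_nz: "\<forall>i<n. L i \<noteq> 0"
    and L_ann: "\<forall>i<n. dop_apply i (L i) f = (\<lambda>_. 0)"
    and r_def: "\<forall>i<n. r i = dop_ord (L i)"
    and d_def: "\<forall>i<n. d i = dop_deg (L i)"
  shows "(\<exists>P :: 'a dop. P \<noteq> 0 \<and> dop_in {1..<n} P \<and>
            dop_apply 1 P (diag21 f) = (\<lambda>_. 0) \<and>
            dop_deg P \<le> 8 * (d 0 + d 1 + 1)^2 * (r 0 * r 1)^2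
                         * (8 * (d 0 + d 1 + 1)^2 * r 0 * r 1 + 1) \<and>
            dop_ord P \<le> 4 * (d 0 + d 1 + 1) * r 0 * r 1)
       \<and> (\<forall>h\<in>{2..<n}. \<exists>P :: 'a dop. P \<noteq> 0 \<and> dop_in {1..<n} P \<and>
            dop_apply h P (diag21 f) = (\<lambda>_. 0) \<and>
            dop_deg P \<le> 8 * (d 0 + d 1 + d h + 1)^2 * (r 0 * r 1 * r h)^2
                         * (8 * (d 0 + d 1 + d h + 1)^2 * r 0 * r 1 * r h + 1) \<and>
            dop_ord P \<le> 4 * (d 0 + d 1 + d h + 1) * r 0 * r 1 * r h)"
proof (intro conjI ballI)
  have zero: "(\<lambda>_. 0) = (0 :: 'a mseries)" by (simp add: fun_eq_iff)
  have sub: "{0, 1, y} \<subseteq> {..<n}" if "y < n" for y using that n2 by auto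
  have main: "\<exists>P :: 'a dop. P \<noteq> 0 \<and> dop_in {1..<n} P \<and> dop_apply y P (diag21 f) = 0 \<and>
    dop_deg P \<le> 8 * ((\<Sum>i\<in>{0, 1, y}. dop_deg (L i)) + 1)\<^sup>2 * (\<Prod>i\<in>{0, 1, y}. dop_ord (L i))\<^sup>2 *
      (8 * ((\<Sum>i\<in>{0, 1, y}. dop_deg (L i)) + 1)\<^sup>2 * (\<Prod>i\<in>{0, 1, y}. dop_ord (L i)) + 1) \<and>
    dop_ord P \<le> 4 * ((\<Sum>i\<in>{0, 1, y}. dop_deg (L i)) + 1) * (\<Prod>i\<in>{0, 1, y}. dop_ord (L i))"
    if "y \<noteq> 0" "y < n" for y
    by (rule diagonal_annihilator[OF that(1) sub[OF that(2)]])
      (use sub[OF that(2)] L_in L_nz L_ann in \<open>auto simp: zero\<close>)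
  show "\<exists>P :: 'a dop. P \<noteq> 0 \<and> dop_in {1..<n} P \<and>
            dop_apply 1 P (diag21 f) = (\<lambda>_. 0) \<and>
            dop_deg P \<le> 8 * (d 0 + d 1 + 1)^2 * (r 0 * r 1)^2
                         * (8 * (d 0 + d 1 + 1)^2 * r 0 * r 1 + 1) \<and>
            dop_ord P \<le> 4 * (d 0 + d 1 + 1) * r 0 * r 1"
  proof -
    have "(\<Sum>i\<in>{0, 1, 1}. dop_deg (L i)) = d 0 + d 1" "(\<Prod>i\<in>{0, 1, 1}. dop_ord (L i)) = r 0 * r 1"
      using r_def d_def n2 by auto
    then show ?thesis using main[of 1] n2 unfolding zero by (simp add: mult.assoc)
  qed
  fix h assume h: "h \<in> {2..<n}"
  show "\<exists>P :: 'a dop. P \<noteq> 0 \<and> dop_in {1..<n} P \<and>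
            dop_apply h P (diag21 f) = (\<lambda>_. 0) \<and>
            dop_deg P \<le> 8 * (d 0 + d 1 + d h + 1)^2 * (r 0 * r 1 * r h)^2
                         * (8 * (d 0 + d 1 + d h + 1)^2 * r 0 * r 1 * r h + 1) \<and>
            dop_ord P \<le> 4 * (d 0 + d 1 + d h + 1) * r 0 * r 1 * r h"
  proof -
    have "(\<Sum>i\<in>{0, 1, h}. dop_deg (L i)) = d 0 + d 1 + d h"
      "(\<Prod>i\<in>{0, 1, h}. dop_ord (L i)) = r 0 * r 1 * r h"
      using r_def d_def n2 h by auto
    then show ?thesis using main[of h] h unfolding zero by (simp add: mult.assoc)
  qed
qed

end
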